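(* Assume that the Coxeter group $\mathcal W$ is nonabelian and irreducible. Then the action of $\mathcal G$ on itself by conjugation has no nontrivial finite orbits (the only finite orbits are singletons consisting of central elements). In particular, the center of any finite index subgroup of $\mathcal G$ is either trivial or equal to $\langle\Delta\rangle$, the latter only if $\Delta$ is central in $\mathcal G$.
   Context: Let $S$ be a finite set, $m$ a Coxeter matrix on $S$ with finite Coxeter group $\mathcal W=\langle S\mid (ss')^{m(s,s')}=1\rangle$, and $\mathcal A=\langle S\mid ss's\cdots=s'ss'\cdots\ (m(s,s')\text{ letters each side})\rangle$ the Artin group. $\mathcal W$ is irreducible if there is no nontrivial partition $S=S_1\sqcup S_2$ with $m(s_1,s_2)=2$ for all $s_1\in S_1$, $s_2\in S_2$. $\Delta\in\mathcal A$ is the positive lift of the longest element of $\mathcal W$ (the element of the submonoid generated by $S$ mapping to the longest element with the same word length); $\Delta^2$ is central, $\mathcal G=\mathcal A/\langle\Delta^2\rangle$, and $\langle\Delta\rangle\subset\mathcal G$ denotes the order-two subgroup generated by the image of $\Delta$. *)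

theory Defs
  imports "HOL-Algebra.Algebra"
begin

text \<open>Words in the generators: a letter (s, True) is s, a letter (s, False) is s^-1.\<close>
type_synonym 'a word = "('a \<times> bool) list"

inductive_set pres_eq :: "'a set \<Rightarrow> ('a word \<times> 'a word) set \<Rightarrow> ('a word \<times> 'a word) set"
  for S :: "'a set" and R :: "('a word \<times> 'a word) set" where
  refl: "w \<in> lists (S \<times> UNIV) \<Longrightarrow> (w, w) \<in> pres_eq S R"
| sym: "(u, v) \<in> pres_eq S R \<Longrightarrow> (v, u) \<in> pres_eq S R"
| trans: "(u, v) \<in> pres_eq S R \<Longrightarrow> (v, w) \<in> pres_eq S R \<Longrightarrow> (u, w) \<in> pres_eq S R"
| rel: "(u, v) \<in> R \<Longrightarrow> (u, v) \<in> pres_eq S R"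
| cancel: "x \<in> S \<Longrightarrow> ([(x, b), (x, \<not> b)], []) \<in> pres_eq S R"
| ctx: "(u, v) \<in> pres_eq S R \<Longrightarrow> w \<in> lists (S \<times> UNIV) \<Longrightarrow> w' \<in> lists (S \<times> UNIV)
        \<Longrightarrow> (w @ u @ w', w @ v @ w') \<in> pres_eq S R"

definition word_class :: "'a set \<Rightarrow> ('a word \<times> 'a word) set \<Rightarrow> 'a word \<Rightarrow> 'a word set" where
  "word_class S R w = pres_eq S R `` {w}"

definition presented_group :: "'a set \<Rightarrow> ('a word \<times> 'a word) set \<Rightarrow> 'a word set monoid" where
  "presented_group S R =
     \<lparr> carrier = lists (S \<times> UNIV) // pres_eq S R,
       monoid.mult = (\<lambda>P Q. word_class S R ((SOME p. p \<in> P) @ (SOME q. q \<in> Q))),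
       one = word_class S R [] \<rparr>"

text \<open>Coxeter matrix on S with (necessarily, since W is finite) finite entries.\<close>
definition coxeter_matrix :: "'a set \<Rightarrow> ('a \<Rightarrow> 'a \<Rightarrow> nat) \<Rightarrow> bool" where
  "coxeter_matrix S m \<longleftrightarrow>
     (\<forall>s\<in>S. m s s = 1) \<and> (\<forall>s\<in>S. \<forall>t\<in>S. m s t = m t s) \<and>
     (\<forall>s\<in>S. \<forall>t\<in>S. s \<noteq> t \<longrightarrow> 2 \<le> m s t)"

definition coxeter_rels :: "'a set \<Rightarrow> ('a \<Rightarrow> 'a \<Rightarrow> nat) \<Rightarrow> ('a word \<times> 'a word) set" where
  "coxeter_rels S m =
     {(concat (replicate (m s t) [(s, True), (t, True)]), []) | s t. s \<in> S \<and> t \<in> S}"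

fun alt_word :: "'a \<Rightarrow> 'a \<Rightarrow> nat \<Rightarrow> 'a word" where
  "alt_word s t 0 = []"
| "alt_word s t (Suc n) = (s, True) # alt_word t s n"

definition artin_rels :: "'a set \<Rightarrow> ('a \<Rightarrow> 'a \<Rightarrow> nat) \<Rightarrow> ('a word \<times> 'a word) set" where
  "artin_rels S m = {(alt_word s t (m s t), alt_word t s (m s t)) | s t. s \<in> S \<and> t \<in> S}"

definition coxeter_group :: "'a set \<Rightarrow> ('a \<Rightarrow> 'a \<Rightarrow> nat) \<Rightarrow> 'a word set monoid" where
  "coxeter_group S m = presented_group S (coxeter_rels S m)"

definition artin_group :: "'a set \<Rightarrow> ('a \<Rightarrow> 'a \<Rightarrow> nat) \<Rightarrow> 'a word set monoid" where
  "artin_group S m = presented_group S (artin_rels S m)"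

definition irreducible_coxeter :: "'a set \<Rightarrow> ('a \<Rightarrow> 'a \<Rightarrow> nat) \<Rightarrow> bool" where
  "irreducible_coxeter S m \<longleftrightarrow>
     \<not> (\<exists>S1 S2. S1 \<noteq> {} \<and> S2 \<noteq> {} \<and> S1 \<union> S2 = S \<and> S1 \<inter> S2 = {} \<and>
          (\<forall>s1\<in>S1. \<forall>s2\<in>S2. m s1 s2 = 2))"

definition coxeter_length :: "'a set \<Rightarrow> ('a \<Rightarrow> 'a \<Rightarrow> nat) \<Rightarrow> 'a word set \<Rightarrow> nat" where
  "coxeter_length S m Xa = (LEAST n. \<exists>w\<in>Xa. length w = n)"

definition is_longest_element :: "'a set \<Rightarrow> ('a \<Rightarrow> 'a \<Rightarrow> nat) \<Rightarrow> 'a word set \<Rightarrow> bool" where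
  "is_longest_element S m Xa \<longleftrightarrow> Xa \<in> carrier (coxeter_group S m) \<and>
     (\<forall>Ya\<in>carrier (coxeter_group S m). coxeter_length S m Ya \<le> coxeter_length S m Xa)"

text \<open>d is a positive word representing the longest element of W, of the same
 length; its class in the Artin group is Delta (independent of the choice of d).\<close>
definition is_Delta_word :: "'a set \<Rightarrow> ('a \<Rightarrow> 'a \<Rightarrow> nat) \<Rightarrow> 'a word \<Rightarrow> bool" where
  "is_Delta_word S m d \<longleftrightarrow> set d \<subseteq> S \<times> {True} \<and>
     is_longest_element S m (word_class S (coxeter_rels S m) d) \<and>
     length d = coxeter_length S m (word_class S (coxeter_rels S m) d)"

text \<open>G = A / <Delta^2>, i.e. the Artin presentation with the extra relation Delta^2 = 1
 (Delta^2 is central, so its normal closure is the cyclic subgroup it generates).\<close>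
definition artin_mod_Delta2 :: "'a set \<Rightarrow> ('a \<Rightarrow> 'a \<Rightarrow> nat) \<Rightarrow> 'a word \<Rightarrow> 'a word set monoid" where
  "artin_mod_Delta2 S m d = presented_group S (artin_rels S m \<union> {(d @ d, [])})"

definition center_of :: "('b, 'c) monoid_scheme \<Rightarrow> 'b set \<Rightarrow> 'b set" where
  "center_of G H = {z \<in> H. \<forall>h\<in>H. z \<otimes>\<^bsub>G\<^esub> h = h \<otimes>\<^bsub>G\<^esub> z}"

definition conj_orbit :: "('b, 'c) monoid_scheme \<Rightarrow> 'b \<Rightarrow> 'b set" where
  "conj_orbit G g = {h \<otimes>\<^bsub>G\<^esub> g \<otimes>\<^bsub>G\<^esub> inv\<^bsub>G\<^esub> h | h. h \<in> carrier G}"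

end

theory Submission
  imports Defs Complex_Main
begin

text \<open>
  If the conjugacy class of \<open>g \<in> \<G>\<close> is finite, pigeonhole shows that \<open>g\<close> commutes with a positive
  power of every generator. As \<open>\<Delta>\<^sup>2\<close> is central and trivial in \<open>\<G>\<close>, \<open>g\<close> is represented by a
  positive word, and comparing lengths turns the commutation relations into relations
  \<open>s\<^sup>k g = g s\<^sup>k\<close> in the Artin monoid. If some generator \<open>r\<close> divides \<open>g\<close> on the left and
  \<open>m(r, s) \<ge> 3\<close>, then \<open>s\<close> divides \<open>g\<close> too. By irreducibility all generators divide \<open>g\<close>, hence so
  does \<open>\<Delta>\<close>; splitting it off and iterating, \<open>g\<close> is a power of \<open>\<Delta>\<close>. Finally \<open>s \<Delta> = \<Delta> \<sigma>(s)\<close>, and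
  \<open>s\<^sup>k \<Delta> = \<Delta> s\<^sup>k\<close> forces \<open>\<sigma>(s) = s\<close>.

  The facts on the Artin monoid (cancellation, least common multiples, \<open>\<Delta>\<close>) rest on the numbers
  game: a group element is replaced by the values of a linear form on the simple roots, a letter
  may be played when its value is positive, and reduced words are exactly the words playable from a
  point with all values positive.
\<close>

section \<open>Braid equivalence of positive words\<close>

fun alt :: "'a \<Rightarrow> 'a \<Rightarrow> nat \<Rightarrow> 'a list" where
  "alt s t 0 = []"
| "alt s t (Suc n) = s # alt t s n"

lemma length_alt [simp]: "length (alt s t n) = n"
  by (induction s t n rule: alt.induct) auto

lemma set_alt: "set (alt s t n) \<subseteq> {s, t}"
  by (induction s t n rule: alt.induct) auto

lemma alt_Suc_snoc: "alt s t (Suc n) = alt s t n @ [if even n then s else t]"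
proof (induction n arbitrary: s t)
  case (Suc n)
  have "alt s t (Suc (Suc n)) = s # alt t s (Suc n)" by simp
  also have "\<dots> = s # alt t s n @ [if even n then t else s]" by (simp only: Suc)
  finally show ?case by simp
qed simp

lemma rev_alt: "rev (alt s t n) = (if even n then alt t s n else alt s t n)"
proof (induction n arbitrary: s t)
  case (Suc n)
  have "rev (alt s t (Suc n)) = (if even n then alt s t n else alt t s n) @ [s]" using Suc by simp
  then show ?case by (auto simp: alt_Suc_snoc simp del: alt.simps(2))
qed simp

text \<open>For involutive generators \<open>rev\<close> is inversion, so this turns the Coxeter
  relator of length \<open>2 * m s t\<close> into a quotient of the two sides of the braid
  relation.\<close>

lemma alt_append_rev_alt: "alt s t n @ rev (alt t s n) = alt s t (2 * n)"
proof (induction n arbitrary: s t)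
  case (Suc n)
  have "alt s t (Suc n) @ rev (alt t s (Suc n)) = s # (alt t s n @ rev (alt s t n)) @ [t]" by simp
  also have "\<dots> = s # alt t s (Suc (2 * n))" by (simp only: Suc alt_Suc_snoc) simp
  finally show ?case by simp
qed simp

locale coxeter_system =
  fixes S :: "'a set" and m :: "'a \<Rightarrow> 'a \<Rightarrow> nat"
  assumes m_diag: "s \<in> S \<Longrightarrow> m s s = 1"
    and m_sym: "s \<in> S \<Longrightarrow> t \<in> S \<Longrightarrow> m s t = m t s"
    and m_ge_2: "s \<in> S \<Longrightarrow> t \<in> S \<Longrightarrow> s \<noteq> t \<Longrightarrow> 2 \<le> m s t"
begin

lemma m_pos: "s \<in> S \<Longrightarrow> t \<in> S \<Longrightarrow> 0 < m s t"
  using m_diag m_ge_2 by (cases "s = t") fastforce+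

lemma alt_m_Cons: "s \<in> S \<Longrightarrow> t \<in> S \<Longrightarrow> alt s t (m s t) = s # alt t s (m s t - 1)"
  using m_pos[of s t] by (cases "m s t") auto

text \<open>The case \<open>s = t\<close> is allowed and changes nothing: \<open>m s s = 1\<close>
  makes both sides \<open>[s]\<close>.\<close>

definition braid_step :: "'a list \<Rightarrow> 'a list \<Rightarrow> bool" where
  "braid_step u v \<longleftrightarrow> (\<exists>x y s t. s \<in> S \<and> t \<in> S \<and>
     u = x @ alt s t (m s t) @ y \<and> v = x @ alt t s (m s t) @ y)"

definition braid_eq :: "'a list \<Rightarrow> 'a list \<Rightarrow> bool" (infix \<open>\<doteq>\<close> 50) where
  "braid_eq = braid_step\<^sup>*\<^sup>*"

lemma braid_eq_refl [simp, intro]: "u \<doteq> u"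
  by (simp add: braid_eq_def)

lemma braid_eq_trans [trans]: "u \<doteq> v \<Longrightarrow> v \<doteq> w \<Longrightarrow> u \<doteq> w"
  by (simp add: braid_eq_def)

lemma braid_step_sym: "braid_step u v \<Longrightarrow> braid_step v u"
  unfolding braid_step_def using m_sym by metis

lemma braid_eq_sym: "u \<doteq> v \<Longrightarrow> v \<doteq> u"
  unfolding braid_eq_def
  by (induction rule: rtranclp_induct) (auto intro: converse_rtranclp_into_rtranclp braid_step_sym)

lemma braid_step_context: "braid_step u v \<Longrightarrow> braid_step (x @ u @ y) (x @ v @ y)"
  unfolding braid_step_def by (metis append.assoc)

lemma braid_eq_context: "u \<doteq> v \<Longrightarrow> x @ u @ y \<doteq> x @ v @ y"
  unfolding braid_eq_def
  by (induction rule: rtranclp_induct) (auto intro: rtranclp.rtrancl_into_rtrancl braid_step_context)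

lemma braid_eq_append: "u \<doteq> u' \<Longrightarrow> v \<doteq> v' \<Longrightarrow> u @ v \<doteq> u' @ v'"
  using braid_eq_context[of u u' "[]" v] braid_eq_context[of v v' u' "[]"]
  by (auto intro: braid_eq_trans)

lemma braid_eq_Cons: "u \<doteq> v \<Longrightarrow> s # u \<doteq> s # v"
  using braid_eq_context[of u v "[s]" "[]"] by simp

lemma braid_eq_alt: "s \<in> S \<Longrightarrow> t \<in> S \<Longrightarrow> alt s t (m s t) @ x \<doteq> alt t s (m s t) @ x"
  unfolding braid_eq_def braid_step_def by (intro r_into_rtranclp exI[of _ "[]"] exI[of _ x] exI[of _ s] exI[of _ t]) simp

lemma braid_eq_length: "u \<doteq> v \<Longrightarrow> length u = length v"
  unfolding braid_eq_def by (induction rule: rtranclp_induct) (auto simp: braid_step_def)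

lemma braid_step_lists: "braid_step u v \<Longrightarrow> u \<in> lists S \<Longrightarrow> v \<in> lists S"
  unfolding braid_step_def using set_alt by fastforce

lemma braid_eq_lists: "u \<doteq> v \<Longrightarrow> u \<in> lists S \<Longrightarrow> v \<in> lists S"
  unfolding braid_eq_def by (induction rule: rtranclp_induct) (use braid_step_lists in blast)+

lemma braid_step_rev:
  assumes "braid_step u v" shows "braid_step (rev u) (rev v)"
proof -
  obtain x y s t where st: "s \<in> S" "t \<in> S"
    and "u = x @ alt s t (m s t) @ y" "v = x @ alt t s (m s t) @ y"
    using assms unfolding braid_step_def by blast
  then have u: "rev u = rev y @ rev (alt s t (m s t)) @ rev x"
    and v: "rev v = rev y @ rev (alt t s (m s t)) @ rev x" by simp_all
  show ?thesis
  proof (cases "even (m s t)")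
    case True
    then have "rev u = rev y @ alt t s (m t s) @ rev x" "rev v = rev y @ alt s t (m t s) @ rev x"
      using u v m_sym[OF st] by (simp_all add: rev_alt)
    then show ?thesis unfolding braid_step_def using st by blast
  next
    case False
    then have "rev u = rev y @ alt s t (m s t) @ rev x" "rev v = rev y @ alt t s (m s t) @ rev x"
      using u v by (simp_all add: rev_alt)
    then show ?thesis unfolding braid_step_def using st by blast
  qed
qed

lemma braid_eq_rev: "u \<doteq> v \<Longrightarrow> rev u \<doteq> rev v"
  unfolding braid_eq_def
  by (induction rule: rtranclp_induct) (auto intro: rtranclp.rtrancl_into_rtrancl braid_step_rev)

section \<open>The numbers game\<close>

text \<open>This is the contragredient geometric representation: \<open>f\<close> lists the values of a linear form
  on the simple roots.\<close>
definition act :: "'a \<Rightarrow> ('a \<Rightarrow> real) \<Rightarrow> 'a \<Rightarrow> real" where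
  "act s f = (\<lambda>u. f u + 2 * cos (pi / m s u) * f s)"

fun run :: "('a \<Rightarrow> real) \<Rightarrow> 'a list \<Rightarrow> 'a \<Rightarrow> real" where
  "run f [] = f"
| "run f (s # u) = run (act s f) u"

lemma run_append [simp]: "run f (u @ v) = run (run f u) v"
  by (induction u arbitrary: f) auto

lemma act_self: "s \<in> S \<Longrightarrow> act s f s = - f s"
  by (simp add: act_def m_diag)

lemma act_act [simp]: "s \<in> S \<Longrightarrow> act s (act s f) = f"
  using act_self[of s f] by (subst act_def) (simp, simp add: act_def)

lemma act_uminus: "act s (\<lambda>u. - f u) = (\<lambda>u. - act s f u)"
  by (auto simp: act_def)

lemma run_uminus: "run (\<lambda>u. - f u) w = (\<lambda>u. - run f w u)"
  by (induction w arbitrary: f) (auto simp: act_uminus)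

lemma run_rev_cancel: "u \<in> lists S \<Longrightarrow> run f (u @ rev u) = f"
  by (induction u arbitrary: f) auto

lemma run_rev_cancel': "u \<in> lists S \<Longrightarrow> run (run f (rev u)) u = f"
  using run_rev_cancel[of "rev u" f] by (simp add: lists_eq_set)

text \<open>Writing \<open>a = r sin \<phi>\<close> and \<open>b = r sin (\<theta> - \<phi>)\<close> for the values at \<open>s\<close> and \<open>t\<close>, this is
  \<open>r sin (\<phi> + x \<theta>)\<close>, the number fired at step \<open>x\<close> when \<open>s\<close> and \<open>t\<close> are fired alternately.\<close>
definition alt_value :: "real \<Rightarrow> real \<Rightarrow> real \<Rightarrow> real \<Rightarrow> real" where
  "alt_value \<theta> a b x = (a * sin ((x + 1) * \<theta>) + b * sin (x * \<theta>)) / sin \<theta>"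

text \<open>The three-term recurrence of the sine is the firing rule \<open>act\<close> for two
  letters at angle \<open>\<theta>\<close>.\<close>

lemma alt_value_rec: "alt_value \<theta> a b (x + 1) = 2 * cos \<theta> * alt_value \<theta> a b x - alt_value \<theta> a b (x - 1)"
proof -
  have *: "sin ((y + 1) * \<theta>) = 2 * cos \<theta> * sin (y * \<theta>) - sin ((y - 1) * \<theta>)" for y
    by (simp add: algebra_simps sin_add sin_diff)
  have "(a * sin ((x + 1 + 1) * \<theta>) + b * sin ((x + 1) * \<theta>)) =
      2 * cos \<theta> * (a * sin ((x + 1) * \<theta>) + b * sin (x * \<theta>)) - (a * sin (x * \<theta>) + b * sin ((x - 1) * \<theta>))"
    by (simp only: *[of "x + 1"] *[of x] add_diff_cancel_right') (simp add: algebra_simps)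
  then show ?thesis by (simp add: alt_value_def diff_divide_distrib)
qed

lemma angle:
  assumes "s \<in> S" "t \<in> S" "s \<noteq> t"
  shows "0 < sin (pi / m s t)"
proof -
  have "2 \<le> real (m s t)" using m_ge_2[OF assms] by simp
  then have "pi / m s t < pi" "0 < pi / m s t" by (simp_all add: field_simps)
  then show ?thesis by (intro sin_gt_zero)
qed

lemma sin_multiple_pos:
  assumes "s \<in> S" "t \<in> S" "0 < k" "k < m s t"
  shows "0 < sin (real k * (pi / m s t))"
  using assms by (intro sin_gt_zero) (auto simp: field_simps)

text \<open>After \<open>k\<close> alternate firings the letter whose turn it is carries the next
  value, and the letter just fired carries minus the value at which it was fired.\<close>

lemma run_alt:
  assumes st: "s \<in> S" "t \<in> S" "s \<noteq> t"
  shows "run f (alt s t k) (if even k then s else t) = alt_value (pi / m s t) (f s) (f t) k \<and>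
         run f (alt s t k) (if even k then t else s) = - alt_value (pi / m s t) (f s) (f t) (real k - 1)"
proof (induction k)
  case 0
  then show ?case using angle[OF st] by (simp add: alt_value_def)
next
  case (Suc k)
  let ?p = "if even k then s else t" and ?q = "if even k then t else s"
  let ?g = "run f (alt s t k)"
  have p: "?p \<in> S" using st by simp
  have m: "m ?p ?q = m s t" using m_sym st by auto
  have g: "run f (alt s t (Suc k)) = act ?p ?g" by (simp add: alt_Suc_snoc del: alt.simps(2))
  have "act ?p ?g ?p = - alt_value (pi / m s t) (f s) (f t) k" using Suc act_self[OF p] by simp
  moreover have "act ?p ?g ?q = alt_value (pi / m s t) (f s) (f t) (real k + 1)"
    unfolding act_def m alt_value_rec using Suc by simp
  ultimately show ?case unfolding g by (auto simp: add.commute)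
qed

text \<open>Here \<open>m s t\<close> times the angle is \<open>pi\<close>. Hence
  \<open>m s t\<close> firings negate both values, whichever letter starts.\<close>

lemma alt_value_end:
  assumes "s \<in> S" "t \<in> S" "s \<noteq> t"
  shows "alt_value (pi / m s t) a b (m s t) = - a" "alt_value (pi / m s t) a b (real (m s t) - 1) = b"
proof -
  let ?n = "real (m s t)" and ?th = "pi / m s t"
  have n: "?n \<noteq> 0" using m_pos[of s t] assms by simp
  have "(?n + 1) * ?th = pi + ?th" "?n * ?th = pi" "(?n - 1) * ?th = pi - ?th"
    using n by (simp_all add: field_simps)
  then show "alt_value ?th a b ?n = - a" "alt_value ?th a b (?n - 1) = b"
    using angle[OF assms] by (simp_all add: alt_value_def sin_diff sin_add)
qed

lemma run_braid:
  assumes "s \<in> S" "t \<in> S"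
  shows "run f (alt s t (m s t)) = run f (alt t s (m s t))"
proof (cases "s = t")
  case False
  note st = assms False
  let ?c = "cos (pi / m s t)" and ?k = "m s t"
  have sym: "m t s = m s t" using m_sym st by simp
  have eq_st: "run f (alt s t ?k) s = run f (alt t s ?k) s \<and> run f (alt s t ?k) t = run f (alt t s ?k) t"
    using run_alt[OF st, of f ?k] run_alt[OF st(2,1) st(3)[symmetric], of f ?k]
      alt_value_end[OF st] alt_value_end[OF st(2,1) st(3)[symmetric]]
    by (auto simp: sym split: if_splits)
  show ?thesis
  proof
    fix u
    let ?x = "cos (pi / m s u)" and ?y = "cos (pi / m t u)"
    \<comment> \<open>For a third letter \<open>u\<close>, subtract from its root the combination of
      the roots of \<open>s\<close> and \<open>t\<close> that leaves a vector orthogonal to both.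
      Both reflections fix that vector, so its value \<open>h\<close> is invariant;
      \<open>\<alpha>\<close> and \<open>\<beta>\<close> solve a linear system with determinant
      \<open>1 - ?c\<^sup>2\<close>.\<close>
    have det: "1 - ?c\<^sup>2 \<noteq> 0" using angle[OF st] sin_squared_eq[of "pi / m s t"] by auto
    define \<alpha> \<beta> where "\<alpha> = - (?x + ?c * ?y) / (1 - ?c\<^sup>2)" and "\<beta> = - (?y + ?c * ?x) / (1 - ?c\<^sup>2)"
    have e: "\<alpha> - \<beta> * ?c = - ?x" "\<beta> - \<alpha> * ?c = - ?y"
      using det unfolding \<alpha>_def \<beta>_def by (simp_all add: divide_simps) (simp_all add: algebra_simps power2_eq_square)
    define h where "h g = g u - \<alpha> * g s - \<beta> * g t" for g
    have hs: "h (act s g) = h g" for g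
    proof -
      have "h (act s g) = h g + 2 * (?x + (\<alpha> - \<beta> * ?c)) * g s"
        unfolding h_def using act_self[OF st(1)] by (simp add: act_def m_diag st algebra_simps)
      then show ?thesis by (simp add: e)
    qed
    have ht: "h (act t g) = h g" for g
    proof -
      have "h (act t g) = h g + 2 * (?y + (\<beta> - \<alpha> * ?c)) * g t"
        unfolding h_def using act_self[OF st(2)] by (simp add: act_def m_diag st sym algebra_simps)
      then show ?thesis by (simp add: e)
    qed
    have h: "h (run g w) = h g" if "set w \<subseteq> {s, t}" for g w
      using that by (induction w arbitrary: g) (auto simp: hs ht)
    have "h (run f (alt s t ?k)) = h (run f (alt t s ?k))"
      using h[of "alt s t ?k"] h[of "alt t s ?k"] set_alt[of s t ?k] set_alt[of t s ?k]
      by (simp add: insert_commute)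
    then show "run f (alt s t ?k) u = run f (alt t s ?k) u"
      unfolding h_def using eq_st by simp
  qed
qed simp

lemma run_braid_eq: "u \<doteq> v \<Longrightarrow> run f u = run f v"
  unfolding braid_eq_def
  by (induction rule: rtranclp_induct) (use run_braid in \<open>fastforce simp: braid_step_def\<close>)+

section \<open>Legal plays and uniqueness of finished games\<close>

fun legal :: "('a \<Rightarrow> real) \<Rightarrow> 'a list \<Rightarrow> bool" where
  "legal f [] = True"
| "legal f (s # u) = (s \<in> S \<and> 0 < f s \<and> legal (act s f) u)"

lemma legal_append [simp]: "legal f (u @ v) \<longleftrightarrow> legal f u \<and> legal (run f u) v"
  by (induction u arbitrary: f) auto

lemma legal_lists: "legal f u \<Longrightarrow> u \<in> lists S"
  by (induction u arbitrary: f) auto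

lemma legal_alt_iff:
  assumes st: "s \<in> S" "t \<in> S" "s \<noteq> t"
  shows "legal f (alt s t k) \<longleftrightarrow> (\<forall>i<k. 0 < alt_value (pi / m s t) (f s) (f t) i)"
proof (induction k)
  case (Suc k)
  have "legal f (alt s t (Suc k)) \<longleftrightarrow>
      legal f (alt s t k) \<and> 0 < run f (alt s t k) (if even k then s else t)"
    using st by (simp add: alt_Suc_snoc del: alt.simps(2))
  then show ?case using Suc run_alt[OF st, of f k] by (auto simp: less_Suc_eq)
qed simp

lemma legal_alt:
  assumes st: "s \<in> S" "t \<in> S" "s \<noteq> t" and f: "0 < f s" "0 \<le> f t" "k < m s t \<or> k = m s t \<and> 0 < f t"
  shows "legal f (alt s t k)"
  unfolding legal_alt_iff[OF st]
proof (intro allI impI)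
  fix i assume i: "i < k"
  let ?th = "pi / m s t"
  have nn: "0 \<le> sin (real i * ?th)" using sin_multiple_pos[OF st(1,2), of i] i f(3) by (cases "i = 0") auto
  show "0 < alt_value ?th (f s) (f t) i"
  proof (cases "Suc i < m s t")
    case True
    then have "0 < sin (real (Suc i) * ?th)" using sin_multiple_pos[OF st(1,2)] by blast
    then have "0 < f s * sin ((real i + 1) * ?th)" "0 \<le> f t * sin (real i * ?th)"
      using f nn by (simp_all add: add.commute)
    then show ?thesis using angle[OF st] by (simp add: alt_value_def)
  next
    \<comment> \<open>At the last of \<open>m s t\<close> firings the first sine vanishes and the
      value is \<open>f t\<close>, which is why \<open>f t\<close> must be strictly positive only
      for full length.\<close>
    case False
    then have *: "m s t = Suc i" "0 < f t" using i f(3) by auto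
    then have "real i = real (m s t) - 1" by simp
    then show ?thesis using alt_value_end(2)[OF st, of "f s" "f t"] * by simp
  qed
qed

text \<open>The first and the last of the \<open>m s t\<close> fired values are \<open>f s\<close>
  and \<open>f t\<close> themselves.\<close>

lemma legal_alt_D:
  assumes st: "s \<in> S" "t \<in> S" "s \<noteq> t" and "legal f (alt s t (m s t))"
  shows "0 < f s" "0 < f t"
proof -
  have l: "0 < alt_value (pi / m s t) (f s) (f t) (real i)" if "i < m s t" for i
    using assms(4) that unfolding legal_alt_iff[OF st] by blast
  have m: "0 < m s t" using m_pos st by blast
  show "0 < f s" using l[of 0] m angle[OF st] by (simp add: alt_value_def)
  show "0 < f t" using l[of "m s t - 1"] m alt_value_end(2)[OF st, of "f s" "f t"] by (simp add: of_nat_diff)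
qed

lemma legal_braid:
  assumes "s \<in> S" "t \<in> S" "legal f (alt s t (m s t))"
  shows "legal f (alt t s (m s t))"
proof (cases "s = t")
  case False
  then show ?thesis using legal_alt_D[OF assms(1,2) False assms(3)] legal_alt[of t s f "m s t"] assms m_sym[OF assms(1,2)]
    by auto
qed (use assms in simp)

lemma legal_braid_eq: "u \<doteq> v \<Longrightarrow> legal f u \<Longrightarrow> legal f v"
  unfolding braid_eq_def
proof (induction rule: rtranclp_induct)
  case (step v w)
  then obtain x y s t where st: "s \<in> S" "t \<in> S"
    and vw: "v = x @ alt s t (m s t) @ y" "w = x @ alt t s (m s t) @ y"
    unfolding braid_step_def by blast
  then show ?case using step legal_braid[OF st, of "run f x"] run_braid[OF st, of "run f x"] by simp
qed

text \<open>A finished game: it ends in the open negative chamber, where no letter is legal any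
  more.\<close>

definition play :: "('a \<Rightarrow> real) \<Rightarrow> 'a list \<Rightarrow> bool" where
  "play f u \<longleftrightarrow> legal f u \<and> (\<forall>s\<in>S. run f u s < 0)"

lemma play_Cons: "play f (s # u) \<longleftrightarrow> s \<in> S \<and> 0 < f s \<and> play (act s f) u"
  by (auto simp: play_def)

lemma play_append: "play f (u @ v) \<longleftrightarrow> legal f u \<and> play (run f u) v"
  by (auto simp: play_def)

lemma play_braid_eq: "u \<doteq> v \<Longrightarrow> play f u \<Longrightarrow> play f v"
  using legal_braid_eq run_braid_eq unfolding play_def by metis

text \<open>Eriksson's strong convergence; this replaces the exchange condition and Matsumoto's theorem.
  The clause \<open>f s \<noteq> 0\<close> is needed in the induction, so that every unplayed letter has a sign.\<close>
lemma play_strong: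
  assumes "play f u"
  shows "(\<forall>s\<in>S. f s \<noteq> 0) \<and> (\<forall>v. legal f v \<longrightarrow> (\<exists>v'. play f (v @ v') \<and> u \<doteq> v @ v'))"
  using assms
proof (induction "length u" arbitrary: f u rule: less_induct)
  case less
  show ?case
  proof (cases u)
    case Nil
    then have neg: "\<forall>s\<in>S. f s < 0" using less.prems by (simp add: play_def)
    have "v = []" if "legal f v" for v using that neg by (cases v) auto
    then show ?thesis using neg Nil less.prems by force
  next
    case (Cons t u')
    then have t: "t \<in> S" "0 < f t" and pl: "play (act t f) u'"
      using less.prems by (simp_all add: play_Cons)
    have IH: "\<exists>v'. play (act t f) (v @ v') \<and> u' \<doteq> v @ v'" if "legal (act t f) v" for v
      using less.hyps[OF _ pl] that Cons by auto
    have "f s \<noteq> 0" if s: "s \<in> S" for s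
    proof
      assume 0: "f s = 0"
      then have ts: "t \<noteq> s" using t by auto
      \<comment> \<open>If \<open>f s = 0\<close>, then \<open>m t s - 1\<close> alternate firings
        starting with \<open>t\<close> are legal and end with the value \<open>f s = 0\<close> at
        the next letter. By the induction hypothesis for \<open>act t f\<close> they extend to a
        finished game, whose shorter remainder contradicts the nonvanishing clause.\<close>
      let ?k = "m t s - 1"
      have m2: "2 \<le> m t s" using m_ge_2[OF t(1) s ts] .
      have "legal f (alt t s ?k)" using legal_alt[OF t(1) s ts, of f] t 0 m2 by simp
      moreover have k: "alt t s ?k = t # alt s t (m t s - 2)" using m2 by (cases ?k) (auto simp: numeral_2_eq_2 intro: arg_cong)
      ultimately have "legal (act t f) (alt s t (m t s - 2))" by simp
      then obtain v' where v': "play (act t f) (alt s t (m t s - 2) @ v')" "u' \<doteq> alt s t (m t s - 2) @ v'"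
        using IH by blast
      have "play (run f (alt t s ?k)) v'" using v'(1) k by (simp add: play_append)
      moreover have "length v' < length u" using braid_eq_length[OF v'(2)] Cons by simp
      ultimately have "\<forall>p\<in>S. run f (alt t s ?k) p \<noteq> 0" using less.hyps by blast
      moreover have "run f (alt t s ?k) (if even ?k then t else s) = 0"
        using run_alt[OF t(1) s ts, of f ?k] alt_value_end(2)[OF t(1) s ts] 0 m2 by (simp add: of_nat_diff)
      ultimately show False using t s by (metis (full_types))
    qed
    moreover have "\<exists>v'. play f (v @ v') \<and> u \<doteq> v @ v'" if v: "legal f v" for v
    proof (cases v)
      case Nil
      then show ?thesis using less.prems by auto
    next
      case v_Cons: (Cons s v0)
      then have s: "s \<in> S" "0 < f s" and v0: "legal (act s f) v0" using v by simp_all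
      show ?thesis
      proof (cases "s = t")
        case True
        then obtain v' where "play (act t f) (v0 @ v')" "u' \<doteq> v0 @ v'" using IH v0 by blast
        then show ?thesis using True v_Cons Cons t by (auto simp: play_Cons intro: braid_eq_Cons)
      next
        case False
        have sym: "m t s = m s t" using m_sym s t by simp
        note al = alt_m_Cons[OF t(1) s(1)] alt_m_Cons[OF s(1) t(1)]
        \<comment> \<open>Both letters are positive, so the full alternating word is legal. The
          induction hypothesis after \<open>t\<close> continues it to a finished game, a braid move
          makes that game start with \<open>s\<close>, and the hypothesis after \<open>s\<close>
          then reaches \<open>v0\<close>.\<close>
        have "legal f (alt t s (m t s))" using legal_alt[OF t(1) s(1)] False s t by auto
        then have "legal (act t f) (alt s t (m t s - 1))" using al by simp
        then obtain v1 where v1: "play (act t f) (alt s t (m t s - 1) @ v1)" "u' \<doteq> alt s t (m t s - 1) @ v1"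
          using IH by blast
        have "play f (alt t s (m t s) @ v1)" using v1(1) t al by (simp add: play_Cons)
        then have "play f (alt s t (m s t) @ v1)" using play_braid_eq braid_eq_alt t s sym by metis
        then have p: "play (act s f) (alt t s (m s t - 1) @ v1)" using al by (simp add: play_Cons)
        have "length (alt t s (m s t - 1) @ v1) < length u"
          using braid_eq_length[OF v1(2)] Cons sym by simp
        then obtain v' where v': "play (act s f) (v0 @ v')" "alt t s (m s t - 1) @ v1 \<doteq> v0 @ v'"
          using less.hyps[OF _ p] v0 by blast
        have "u \<doteq> alt t s (m t s) @ v1" using braid_eq_Cons[OF v1(2)] Cons al by simp
        also have "\<dots> \<doteq> alt s t (m t s) @ v1" by (rule braid_eq_alt[OF t(1) s(1)])
        also have "\<dots> \<doteq> v @ v'" using braid_eq_Cons[OF v'(2)] al sym v_Cons by simp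
        finally show ?thesis using v' v_Cons s by (auto simp: play_Cons)
      qed
    qed
    ultimately show ?thesis by blast
  qed
qed

lemma play_nonzero: "play f u \<Longrightarrow> s \<in> S \<Longrightarrow> f s \<noteq> 0"
  using play_strong by blast

lemma play_extend:
  assumes "play f u" "legal f v"
  obtains v' where "play f (v @ v')" "u \<doteq> v @ v'"
  using play_strong assms by blast

lemma play_unique:
  assumes "play f u" "play f v" shows "u \<doteq> v"
proof -
  obtain v' where v': "play f (v @ v')" "u \<doteq> v @ v'"
    using play_extend assms unfolding play_def by metis
  moreover have "v' = []"
  proof (cases v')
    case (Cons s x)
    then show ?thesis using v'(1) assms(2) by (force simp: play_def)
  qed simp
  ultimately show ?thesis by simp
qed

end

section \<open>Reduced words of the Coxeter group\<close>

lemma rev_in_lists: "rev u \<in> lists A \<longleftrightarrow> u \<in> lists A"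
  by (simp add: lists_eq_set)

lemma pres_eq_lists:
  assumes "(u, v) \<in> pres_eq S R" "R \<subseteq> lists (S \<times> UNIV) \<times> lists (S \<times> UNIV)"
  shows "u \<in> lists (S \<times> UNIV)" "v \<in> lists (S \<times> UNIV)"
  using assms by (induction rule: pres_eq.induct) auto

abbreviation pos :: "'a list \<Rightarrow> 'a word" where
  "pos \<equiv> map (\<lambda>s. (s, True))"

lemma pos_lists [simp]: "pos u \<in> lists (S \<times> UNIV) \<longleftrightarrow> u \<in> lists S"
  by (induction u) auto

lemma map_fst_pos [simp]: "map fst (pos u) = u"
  by (induction u) auto

lemma alt_word_eq: "alt_word s t n = pos (alt s t n)"
  by (induction s t n rule: alt_word.induct) auto

lemma concat_replicate_alt: "concat (replicate n [(s, True), (t, True)]) = pos (alt s t (2 * n))"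
  by (induction n) auto

context coxeter_system
begin

lemma coxeter_rels_eq: "coxeter_rels S m = {(pos (alt s t (2 * m s t)), []) | s t. s \<in> S \<and> t \<in> S}"
  unfolding coxeter_rels_def concat_replicate_alt ..

lemma alt_lists: "s \<in> S \<Longrightarrow> t \<in> S \<Longrightarrow> alt s t n \<in> lists S"
  using set_alt[of s t n] by auto

lemma coxeter_rels_lists: "coxeter_rels S m \<subseteq> lists (S \<times> UNIV) \<times> lists (S \<times> UNIV)"
  unfolding coxeter_rels_eq using alt_lists pos_lists by fastforce

text \<open>Equality in the Coxeter group, restricted to positive words; these represent every
  element because the generators are involutions.\<close>

definition weq :: "'a list \<Rightarrow> 'a list \<Rightarrow> bool" where
  "weq u v \<longleftrightarrow> (pos u, pos v) \<in> pres_eq S (coxeter_rels S m)"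

lemma weq_lists: "weq u v \<Longrightarrow> u \<in> lists S" "weq u v \<Longrightarrow> v \<in> lists S"
  unfolding weq_def using pres_eq_lists[OF _ coxeter_rels_lists] pos_lists by metis+

lemma weq_refl: "u \<in> lists S \<Longrightarrow> weq u u"
  unfolding weq_def by (rule pres_eq.refl) simp

lemma weq_sym: "weq u v \<Longrightarrow> weq v u"
  unfolding weq_def by (rule pres_eq.sym)

lemma weq_trans [trans]: "weq u v \<Longrightarrow> weq v w \<Longrightarrow> weq u w"
  unfolding weq_def by (rule pres_eq.trans)

lemma weq_context: "weq u v \<Longrightarrow> x \<in> lists S \<Longrightarrow> y \<in> lists S \<Longrightarrow> weq (x @ u @ y) (x @ v @ y)"
  unfolding weq_def using pres_eq.ctx[of "pos u" "pos v" _ _ "pos x" "pos y"] pos_lists by simp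

lemma weq_square: "s \<in> S \<Longrightarrow> weq [s, s] []"
  unfolding weq_def
  by (rule pres_eq.rel) (use m_diag in \<open>force simp: coxeter_rels_def intro!: exI[of _ s]\<close>)

lemma weq_rev_cancel: "u \<in> lists S \<Longrightarrow> weq (u @ rev u) []"
proof (induction u)
  case (Cons s u)
  have "weq ([s] @ (u @ rev u) @ [s]) ([s] @ [] @ [s])" using Cons by (intro weq_context) auto
  also have "weq ([s] @ [] @ [s]) []" using weq_square Cons by simp
  finally show ?case by simp
qed (simp add: weq_refl)

lemma weq_alt:
  assumes st: "s \<in> S" "t \<in> S"
  shows "weq (alt s t (m s t)) (alt t s (m s t))"
proof -
  let ?u = "alt s t (m s t)" and ?v = "alt t s (m s t)"
  have l: "?u \<in> lists S" "?v \<in> lists S" "rev ?v \<in> lists S" using st alt_lists by (simp_all add: rev_in_lists)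
  have "weq ?v (?u @ rev ?v @ ?v)"
  proof -
    have "weq (?u @ rev ?v) []"
      unfolding weq_def alt_append_rev_alt list.map by (rule pres_eq.rel) (use st in \<open>auto simp: coxeter_rels_eq\<close>)
    from weq_context[OF weq_sym[OF this], of "[]" ?v] show ?thesis using l by simp
  qed
  also have "weq \<dots> ?u"
    using weq_context[OF weq_rev_cancel[of "rev ?v"], of ?u "[]"] l by simp
  finally show ?thesis by (rule weq_sym)
qed

lemma braid_eq_weq: "u \<doteq> v \<Longrightarrow> u \<in> lists S \<Longrightarrow> weq u v"
  unfolding braid_eq_def
proof (induction rule: rtranclp_induct)
  case (step v w)
  then obtain x y s t where st: "s \<in> S" "t \<in> S"
    and vw: "v = x @ alt s t (m s t) @ y" "w = x @ alt t s (m s t) @ y"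
    unfolding braid_step_def by blast
  have "weq u v" using step by blast
  from weq_lists(2)[OF this] have "x \<in> lists S" "y \<in> lists S" using vw by simp_all
  then have "weq v w" unfolding vw using weq_context weq_alt st by blast
  with \<open>weq u v\<close> show ?case by (rule weq_trans)
qed (rule weq_refl)

text \<open>The numbers game is a representation of the Coxeter group. Signs of letters may be
  dropped because each letter acts as an involution.\<close>

lemma weq_run:
  assumes "weq u v" shows "run f u = run f v"
proof -
  have "run f (map fst a) = run f (map fst b)" if "(a, b) \<in> pres_eq S (coxeter_rels S m)" for f a b
    using that
  proof (induction arbitrary: f rule: pres_eq.induct)
    case (rel a b)
    then obtain s t where st: "s \<in> S" "t \<in> S" and ab: "a = pos (alt s t (2 * m s t))" "b = []"
      unfolding coxeter_rels_eq by blast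
    have "run f (map fst a) = run f (alt t s (m s t) @ rev (alt t s (m s t)))"
      using run_braid[OF st] unfolding ab map_fst_pos alt_append_rev_alt[symmetric] by simp
    also have "\<dots> = f" by (intro run_rev_cancel alt_lists st)
    finally show ?case by (simp add: ab)
  qed auto
  from this[of "pos u" "pos v"] assms show ?thesis unfolding weq_def map_fst_pos .
qed

lemma weq_rev:
  assumes "weq u v" shows "weq (rev u) (rev v)"
proof -
  have "(rev a, rev b) \<in> pres_eq S (coxeter_rels S m)" if "(a, b) \<in> pres_eq S (coxeter_rels S m)" for a b
    using that
  proof (induction rule: pres_eq.induct)
    case (refl w)
    then show ?case by (intro pres_eq.refl) (auto simp: lists_eq_set)
  next
    case (rel a b)
    then obtain s t where st: "s \<in> S" "t \<in> S" and ab: "a = pos (alt s t (2 * m s t))" "b = []"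
      unfolding coxeter_rels_eq by blast
    then have "rev a = pos (alt t s (2 * m t s))" using m_sym by (simp add: rev_map rev_alt)
    then show ?case using st ab by (intro pres_eq.rel) (auto simp: coxeter_rels_eq)
  next
    case (cancel x b)
    then show ?case using pres_eq.cancel[of x S "\<not> b" "coxeter_rels S m"] by simp
  next
    case (ctx u v w w')
    then show ?case using pres_eq.ctx[of "rev u" "rev v" S "coxeter_rels S m" "rev w'" "rev w"]
      by (simp add: rev_in_lists)
  qed (blast intro: pres_eq.sym pres_eq.trans)+
  from this[of "pos u" "pos v"] assms show ?thesis by (simp add: weq_def rev_map)
qed

section \<open>Reducedness decided by the numbers game\<close>

definition reduced :: "'a list \<Rightarrow> bool" where
  "reduced w \<longleftrightarrow> w \<in> lists S \<and> (\<forall>v. weq w v \<longrightarrow> length w \<le> length v)"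

lemma reduced_rev: "reduced w \<Longrightarrow> reduced (rev w)"
  unfolding reduced_def using weq_rev by (fastforce simp: rev_in_lists)

text \<open>Playing \<open>w\<close> from \<open>run f (rev w)\<close> leads back to
  \<open>f\<close>, though perhaps not legally. Building \<open>w\<close> from its last letter, a
  new letter \<open>s\<close> is prepended to the game if its value is negative; otherwise the game
  can be rewritten to start with \<open>s\<close>, and the two letters cancel.\<close>

lemma exists_play:
  assumes f: "\<forall>s\<in>S. f s < 0" and "w \<in> lists S"
  shows "\<exists>u. play (run f (rev w)) u \<and> weq w u \<and> length u \<le> length w"
  using assms(2)
proof (induction w)
  case Nil
  then show ?case using f by (auto simp: play_def weq_refl)
next
  case (Cons s w)
  let ?g = "run f (rev w)"
  obtain u where u: "play ?g u" "weq w u" "length u \<le> length w" using Cons by auto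
  have s: "s \<in> S" using Cons by simp
  have g: "run f (rev (s # w)) = act s ?g" by simp
  have wu: "weq (s # w) (s # u)" using weq_context[OF u(2), of "[s]" "[]"] s by simp
  show ?case
  proof (cases "?g s < 0")
    case True
    then have "play (act s ?g) (s # u)" using u s by (simp add: play_Cons act_self)
    then show ?thesis using wu u(3) g by auto
  next
    case False
    then have "legal ?g [s]" using play_nonzero[OF u(1) s] s by simp
    then obtain v where v: "play ?g ([s] @ v)" "u \<doteq> [s] @ v" using play_extend u(1) by blast
    have "weq (s # u) (s # s # v)"
      using weq_context[OF braid_eq_weq[OF v(2)], of "[s]" "[]"] weq_lists[OF u(2)] s by simp
    with wu have "weq (s # w) (s # s # v)" by (rule weq_trans)
    also have "weq (s # s # v) v"
      using weq_context[OF weq_square[OF s], of "[]" v] weq_lists[OF \<open>weq (s # u) (s # s # v)\<close>] by simp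
    finally have "weq (s # w) v" .
    moreover have "play (act s ?g) v" using v by (simp add: play_Cons)
    moreover have "length v \<le> length (s # w)" using braid_eq_length[OF v(2)] u(3) by simp
    ultimately show ?thesis using g by metis
  qed
qed

text \<open>A finished game is unique up to braid moves and by \<open>exists_play\<close> no
  representative is shorter than it. Conversely, if prepending a letter to a game were not legal,
  that letter would cancel and the word would not be reduced.\<close>

lemma reduced_iff_play:
  assumes f: "\<forall>s\<in>S. f s < 0" and w: "w \<in> lists S"
  shows "reduced w \<longleftrightarrow> play (run f (rev w)) w"
proof
  assume pl: "play (run f (rev w)) w"
  have "length w \<le> length v" if v: "weq w v" for v
  proof -
    obtain u where u: "play (run f (rev v)) u" "length u \<le> length v"
      using exists_play[OF f] weq_lists(2)[OF v] by blast
    moreover have "run f (rev v) = run f (rev w)" using weq_run[OF weq_rev[OF v]] by simp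
    ultimately have "w \<doteq> u" using play_unique pl by metis
    then show ?thesis using braid_eq_length u(2) by metis
  qed
  then show "reduced w" using w by (simp add: reduced_def)
next
  assume "reduced w"
  then have *: "weq w u \<Longrightarrow> length w \<le> length u" for u by (simp add: reduced_def)
  show "play (run f (rev w)) w" using w *
  proof (induction w rule: list.induct)
    case (Cons s w)
    let ?g = "run f (rev w)"
    have s: "s \<in> S" "w \<in> lists S" using Cons.prems(1) by simp_all
    have "length w \<le> length u" if "weq w u" for u
      using Cons.prems(2)[of "s # u"] weq_context[OF that, of "[s]" "[]"] s by simp
    then have pl: "play ?g w" using Cons.IH s by blast
    have "\<not> 0 < ?g s"
    proof
      assume "0 < ?g s"
      then have "legal ?g [s]" using s by simp
      then obtain v where v: "w \<doteq> [s] @ v" using play_extend pl by blast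
      have w: "weq w (s # v)" using braid_eq_weq[OF v s(2)] by simp
      then have "weq (s # w) (s # s # v)" using weq_context[of _ _ "[s]" "[]"] s by fastforce
      also have "weq (s # s # v) v" using weq_context[OF weq_square[OF s(1)], of "[]" v] weq_lists[OF w] by simp
      finally have "length (s # w) \<le> length v" using Cons.prems(2) by blast
      then show False using braid_eq_length[OF v] by simp
    qed
    then have "?g s < 0" using play_nonzero[OF pl s(1)] by force
    then show ?case using pl s by (simp add: play_Cons act_self)
  qed (use f in \<open>simp add: play_def\<close>)
qed

text \<open>Time reversal: a letter fired at a positive value carries the opposite value afterwards,
  so a game run backwards is legal for the negated values.\<close>

lemma legal_rev:
  assumes "w \<in> lists S"
  shows "legal (run f (rev w)) w \<longleftrightarrow> legal (\<lambda>u. - f u) (rev w)"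
  using assms by (induction w) (auto simp: run_uminus act_self)

text \<open>Time reversal replaces the start in \<open>reduced_iff_play\<close>, which depends on
  \<open>w\<close>, by one common start in the open positive chamber.\<close>

lemma reduced_iff_legal:
  assumes "\<forall>s\<in>S. 0 < f s" and w: "w \<in> lists S"
  shows "reduced w \<longleftrightarrow> legal f w"
proof -
  let ?f = "\<lambda>u. - f u"
  have rw: "rev w \<in> lists S" using w by (simp add: rev_in_lists)
  have neg: "\<forall>s\<in>S. ?f s < 0" using assms by simp
  have "reduced w \<longleftrightarrow> reduced (rev w)" using reduced_rev[of w] reduced_rev[of "rev w"] by auto
  also have "\<dots> \<longleftrightarrow> play (run ?f w) (rev w)" using reduced_iff_play[OF neg rw] by simp
  also have "\<dots> \<longleftrightarrow> legal (run ?f w) (rev w)"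
    unfolding play_def using run_rev_cancel'[OF rw, of ?f] neg by simp
  also have "\<dots> \<longleftrightarrow> legal f w" using legal_rev[OF rw, of ?f] by simp
  finally show ?thesis .
qed

lemma reduced_iff_legal_one: "w \<in> lists S \<Longrightarrow> reduced w \<longleftrightarrow> legal (\<lambda>_. 1) w"
  by (rule reduced_iff_legal) simp

lemma reduced_braid_eq: "u \<doteq> v \<Longrightarrow> reduced u \<Longrightarrow> reduced v"
  using legal_braid_eq legal_lists reduced_iff_legal_one unfolding reduced_def by metis

text \<open>Both first letters have positive values at the start of the game, so the full
  alternating word is legal and \<open>play_extend\<close> supplies the common remainder
  \<open>e\<close>.\<close>

lemma reduced_two_heads:
  assumes s: "reduced (s # a)" and u: "s # a \<doteq> u # c"
  shows "\<exists>e. a \<doteq> alt u s (m s u - 1) @ e \<and> c \<doteq> alt s u (m s u - 1) @ e"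
proof -
  let ?g = "run (\<lambda>_. -1) (rev (s # a))"
  have sa: "s # a \<in> lists S" using s by (simp add: reduced_def)
  have "play ?g (s # a)" using reduced_iff_play[of "\<lambda>_. -1", OF _ sa] s by simp
  then have ps: "s \<in> S" "0 < ?g s" "play (act s ?g) a" by (simp_all only: play_Cons)
  have "play ?g (u # c)" using play_braid_eq[OF u] \<open>play ?g (s # a)\<close> by blast
  then have pu: "u \<in> S" "0 < ?g u" "play (act u ?g) c" by (simp_all only: play_Cons)
  show ?thesis
  proof (cases "s = u")
    case True
    then have "a \<doteq> c" using ps pu play_unique by blast
    then show ?thesis using True ps m_diag by auto
  next
    case False
    note al = alt_m_Cons[OF ps(1) pu(1)] alt_m_Cons[OF pu(1) ps(1)] m_sym[OF ps(1) pu(1)]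
    have "legal ?g (alt s u (m s u))" by (rule legal_alt[OF ps(1) pu(1) False]) (use ps pu in auto)
    then have "legal (act s ?g) (alt u s (m s u - 1))" using al by (simp del: run.simps)
    then obtain e where e: "play (act s ?g) (alt u s (m s u - 1) @ e)" "a \<doteq> alt u s (m s u - 1) @ e"
      using play_extend ps(3) by blast
    have "play ?g (alt s u (m s u) @ e)" using e(1) ps al(1) by (simp add: play_Cons del: run.simps)
    then have "play ?g (alt u s (m u s) @ e)" using play_braid_eq[OF braid_eq_alt[OF ps(1) pu(1)]] al(3) by simp
    then have "play (act u ?g) (alt s u (m s u - 1) @ e)" using al(2,3) by (simp add: play_Cons del: run.simps)
    then show ?thesis using e(2) play_unique[OF pu(3)] by blast
  qed
qed

section \<open>Cancellation and least common multiples of positive words\<close>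

text \<open>Both \<open>s # a\<close> and \<open>t # b\<close> are the least common multiple of
  \<open>s\<close> and \<open>t\<close> followed by the same \<open>e\<close>. For
  \<open>s = t\<close> this is left cancellation.\<close>

definition factors_through_lcm :: "'a \<Rightarrow> 'a list \<Rightarrow> 'a \<Rightarrow> 'a list \<Rightarrow> bool" where
  "factors_through_lcm s a t b \<longleftrightarrow> (\<exists>e. a \<doteq> alt t s (m s t - 1) @ e \<and> b \<doteq> alt s t (m s t - 1) @ e)"

text \<open>The reduction lemma for Artin monoids, bounded by length because its induction step uses
  cancellation and joins of smaller length.\<close>

definition reduction_upto :: "nat \<Rightarrow> bool" where
  "reduction_upto n \<longleftrightarrow> (\<forall>s\<in>S. \<forall>t\<in>S. \<forall>a b. s # a \<doteq> t # b \<and> length a < n \<longrightarrow> factors_through_lcm s a t b)"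

lemma reduction_uptoD:
  "reduction_upto n \<Longrightarrow> s # a \<doteq> t # b \<Longrightarrow> s \<in> S \<Longrightarrow> t \<in> S \<Longrightarrow> length a < n \<Longrightarrow> factors_through_lcm s a t b"
  unfolding reduction_upto_def by blast

lemma factors_through_lcm_same: "factors_through_lcm s a s b \<Longrightarrow> s \<in> S \<Longrightarrow> a \<doteq> b"
  unfolding factors_through_lcm_def using m_diag by (auto intro: braid_eq_trans braid_eq_sym)

lemma cancel_upto:
  "reduction_upto n \<Longrightarrow> u @ a \<doteq> u @ b \<Longrightarrow> u \<in> lists S \<Longrightarrow> length (u @ a) \<le> n \<Longrightarrow> a \<doteq> b"
proof (induction u)
  case (Cons s u)
  then have "u @ a \<doteq> u @ b" using reduction_uptoD[of n s "u @ a" s "u @ b"] factors_through_lcm_same[of s] by auto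
  then show ?case using Cons by auto
qed simp

text \<open>The start \<open>g\<close> is arbitrary because the induction peels letters off \<open>p\<close> and \<open>q\<close>, which moves \<open>g\<close>.\<close>
lemma join_upto:
  assumes R: "reduction_upto n"
  shows "legal g p \<Longrightarrow> legal g q \<Longrightarrow> p @ x \<doteq> q @ y \<Longrightarrow> length (p @ x) \<le> n \<Longrightarrow>
    \<exists>w p' q' z. legal g w \<and> w \<doteq> p @ p' \<and> w \<doteq> q @ q' \<and> w @ z \<doteq> p @ x"
proof (induction "length (p @ x)" arbitrary: g p q x y rule: less_induct)
  case less
  show ?case
  proof (cases "p = [] \<or> q = []")
    case True
    then show ?thesis
    proof
      assume "p = []"
      then show ?thesis using less.prems
        by (intro exI[of _ q] exI[of _ "[]"] exI[of _ y]) (auto intro: braid_eq_sym)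
    next
      assume "q = []"
      then show ?thesis using less.prems by (intro exI[of _ p] exI[of _ "[]"] exI[of _ x]) auto
    qed
  next
    case False
    then obtain s p0 u q0 where p: "p = s # p0" and q: "q = u # q0" by (meson neq_Nil_conv)
    have s: "s \<in> S" "0 < g s" "legal (act s g) p0" and u: "u \<in> S" "0 < g u" "legal (act u g) q0"
      using less.prems p q by simp_all
    note al = alt_m_Cons[OF s(1) u(1)] alt_m_Cons[OF u(1) s(1)] m_sym[OF s(1) u(1)]
    let ?k = "m s u - 1"
    have "factors_through_lcm s (p0 @ x) u (q0 @ y)"
      by (rule reduction_uptoD[OF R]) (use less.prems p q s u in auto)
    then obtain e where e: "p0 @ x \<doteq> alt u s ?k @ e" "q0 @ y \<doteq> alt s u ?k @ e"
      unfolding factors_through_lcm_def by blast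
    have n1: "length (p0 @ x) < length (p @ x)" "length (p0 @ x) \<le> n" using less.prems p by simp_all
    have len: "length (q0 @ y) = length (p0 @ x)" using braid_eq_length[OF less.prems(3)] p q by simp
    have "legal g (alt s u (m s u))"
    proof (cases "s = u")
      case False
      then show ?thesis using legal_alt[OF s(1) u(1)] s u by auto
    qed (use s m_diag in simp)
    then have "legal (act s g) (alt u s ?k)" using al by simp
    \<comment> \<open>First join \<open>p0\<close> with the rest of the least common multiple of
      \<open>s\<close> and \<open>u\<close>. The result, rewritten to start with \<open>u\<close>,
      is then joined with \<open>q0\<close>.\<close>
    then obtain w1 p1 q1 z1 where w1: "legal (act s g) w1" "w1 \<doteq> p0 @ p1" "w1 \<doteq> alt u s ?k @ q1"
      "w1 @ z1 \<doteq> p0 @ x"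
      using less.hyps[OF n1(1) s(3) _ e(1) n1(2)] by blast
    have "alt u s ?k @ q1 @ z1 \<doteq> w1 @ z1"
      using braid_eq_append[OF w1(3) braid_eq_refl, of z1] by (auto intro: braid_eq_sym)
    also have "\<dots> \<doteq> p0 @ x" by (rule w1(4))
    also have "\<dots> \<doteq> alt u s ?k @ e" by (rule e(1))
    finally have c: "alt u s ?k @ q1 @ z1 \<doteq> alt u s ?k @ e" .
    have "length (alt u s ?k @ q1 @ z1) \<le> n"
      using braid_eq_length[OF c] braid_eq_length[OF e(1)] n1(2) by simp
    then have "q1 @ z1 \<doteq> e" using cancel_upto[OF R c] alt_lists s u by blast
    then have "q0 @ y \<doteq> (alt s u ?k @ q1) @ z1"
      using braid_eq_trans[OF e(2)] braid_eq_append[OF braid_eq_refl] braid_eq_sym by (metis append.assoc)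
    moreover have sw1: "s # w1 \<doteq> alt u s (m u s) @ q1"
    proof -
      have "s # w1 \<doteq> alt s u (m s u) @ q1" using braid_eq_Cons[OF w1(3)] al by simp
      also have "\<dots> \<doteq> alt u s (m s u) @ q1" by (rule braid_eq_alt[OF s(1) u(1)])
      finally show ?thesis using al by simp
    qed
    moreover have "legal (act u g) (alt s u ?k @ q1)"
    proof -
      have "legal g (s # w1)" using s w1 by simp
      then have "legal g (alt u s (m u s) @ q1)" using sw1 legal_braid_eq by blast
      then show ?thesis using al by simp
    qed
    ultimately obtain w2 q' r z where w2: "legal (act u g) w2" "w2 \<doteq> q0 @ q'"
      "w2 \<doteq> (alt s u ?k @ q1) @ r" "w2 @ z \<doteq> q0 @ y"
      using less.hyps[of q0 y, OF _ u(3), of "alt s u ?k @ q1" z1] len n1 by auto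
    have "u # w2 \<doteq> u # alt s u ?k @ q1 @ r" using braid_eq_Cons[OF w2(3)] by simp
    also have "\<dots> = (alt u s (m u s) @ q1) @ r" using al by simp
    also have "\<dots> \<doteq> (s # w1) @ r" by (intro braid_eq_append braid_eq_refl braid_eq_sym[OF sw1])
    also have "\<dots> \<doteq> (s # p0 @ p1) @ r" by (intro braid_eq_append braid_eq_refl braid_eq_Cons w1)
    finally have "u # w2 \<doteq> p @ p1 @ r" using p by simp
    moreover have "legal g (u # w2)" using w2 u by simp
    moreover have "u # w2 \<doteq> q @ q'" using braid_eq_Cons[OF w2(2)] q by simp
    moreover have "(u # w2) @ z \<doteq> p @ x"
      using braid_eq_trans[OF braid_eq_Cons[OF w2(4), of u] braid_eq_sym[of "p @ x"]] less.prems(3) q by simp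
    ultimately show ?thesis by blast
  qed
qed

text \<open>A braid move at the front is itself the relation between the two heads; a move further
  right keeps the head and changes only the tail.\<close>

lemma factors_through_lcm_braid_step:
  assumes "braid_step (s # a) y" "s \<in> S"
  obtains t b where "y = t # b" "t \<in> S" "factors_through_lcm s a t b"
proof -
  obtain x z p q where pq: "p \<in> S" "q \<in> S"
    and eq: "s # a = x @ alt p q (m p q) @ z" "y = x @ alt q p (m p q) @ z"
    using assms(1) unfolding braid_step_def by blast
  note al = alt_m_Cons[OF pq] alt_m_Cons[OF pq(2,1)] m_sym[OF pq]
  show thesis
  proof (cases x)
    case Nil
    then have "s = p" "a = alt q p (m p q - 1) @ z" "y = q # alt p q (m p q - 1) @ z" using eq al by auto
    then show thesis using that[of q] pq unfolding factors_through_lcm_def by auto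
  next
    case (Cons s' x')
    then have "a = x' @ alt p q (m p q) @ z" "y = s # x' @ alt q p (m p q) @ z" using eq by auto
    moreover have "a \<doteq> x' @ alt q p (m p q) @ z"
      unfolding calculation braid_eq_def by (rule r_into_rtranclp) (use pq in \<open>auto simp: braid_step_def\<close>)
    ultimately show thesis using that[of s] assms(2) m_diag unfolding factors_through_lcm_def by auto
  qed
qed

text \<open>The least common multiples of \<open>t\<close> with \<open>s\<close> and with
  \<open>u\<close> are joined into one reduced word \<open>t # w\<close>. This word has heads
  \<open>s\<close> and \<open>u\<close>, so \<open>reduced_two_heads\<close> applies, without a case
  analysis on the three letters; the unreduced rest \<open>z\<close> is carried along.\<close>

lemma factors_through_lcm_trans:
  assumes R: "reduction_upto n" and S: "s \<in> S" "t \<in> S" "u \<in> S"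
    and ab: "factors_through_lcm s a t b" and bc: "factors_through_lcm t b u c" and n: "length b \<le> n"
  shows "factors_through_lcm s a u c"
proof -
  let ?p = "alt s t (m s t - 1)" and ?q = "alt u t (m t u - 1)"
  let ?p' = "alt t s (m s t - 1)" and ?q' = "alt t u (m t u - 1)"
  obtain e1 where e1: "a \<doteq> ?p' @ e1" "b \<doteq> ?p @ e1" using ab unfolding factors_through_lcm_def by blast
  obtain e2 where e2: "b \<doteq> ?q @ e2" "c \<doteq> ?q' @ e2" using bc unfolding factors_through_lcm_def by blast
  have legal: "legal (\<lambda>_. 1) (alt t v (m t v))" if "v \<in> S" for v
  proof (cases "t = v")
    case False
    then show ?thesis using legal_alt[OF S(2) that] by auto
  qed (use S m_diag in simp)
  have "legal (act t (\<lambda>_. 1)) ?p" using legal[OF S(1)] alt_m_Cons[OF S(2,1)] m_sym[OF S(1,2)] by simp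
  moreover have "legal (act t (\<lambda>_. 1)) ?q" using legal[OF S(3)] alt_m_Cons[OF S(2,3)] by simp
  moreover have pe: "?p @ e1 \<doteq> ?q @ e2" using e1 e2 braid_eq_trans braid_eq_sym by blast
  moreover have pn: "length (?p @ e1) \<le> n" using braid_eq_length[OF e1(2)] n by simp
  ultimately obtain w p1 q1 z where w: "legal (act t (\<lambda>_. 1)) w" "w \<doteq> ?p @ p1" "w \<doteq> ?q @ q1"
    "w @ z \<doteq> ?p @ e1"
    using join_upto[OF R] by blast
  have "?p @ p1 @ z \<doteq> w @ z" using braid_eq_append[OF braid_eq_sym[OF w(2)] braid_eq_refl] by simp
  also have wz: "\<dots> \<doteq> ?p @ e1" by (rule w(4))
  finally have c1: "?p @ p1 @ z \<doteq> ?p @ e1" .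
  then have e1': "e1 \<doteq> p1 @ z"
    using cancel_upto[OF R _ alt_lists[OF S(1,2)]] braid_eq_length[OF c1] pn braid_eq_sym by (metis (no_types))
  have "?q @ q1 @ z \<doteq> w @ z" using braid_eq_append[OF braid_eq_sym[OF w(3)] braid_eq_refl] by simp
  also note wz
  also note pe
  finally have c2: "?q @ q1 @ z \<doteq> ?q @ e2" .
  then have e2': "e2 \<doteq> q1 @ z"
    using cancel_upto[OF R _ alt_lists[OF S(3,2)]] braid_eq_length[OF c2] braid_eq_length[OF pe] pn braid_eq_sym
    by (metis (no_types))
  have tws: "t # w \<doteq> s # ?p' @ p1"
  proof -
    have "t # w \<doteq> alt t s (m t s) @ p1"
      using braid_eq_Cons[OF w(2)] alt_m_Cons[OF S(2,1)] m_sym[OF S(1,2)] by simp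
    also have "\<dots> \<doteq> alt s t (m t s) @ p1" by (rule braid_eq_alt[OF S(2,1)])
    finally show ?thesis using alt_m_Cons[OF S(1,2)] m_sym[OF S(1,2)] by simp
  qed
  have twu: "t # w \<doteq> u # ?q' @ q1"
  proof -
    have "t # w \<doteq> alt t u (m t u) @ q1" using braid_eq_Cons[OF w(3)] alt_m_Cons[OF S(2,3)] by simp
    also have "\<dots> \<doteq> alt u t (m t u) @ q1" by (rule braid_eq_alt[OF S(2,3)])
    finally show ?thesis using alt_m_Cons[OF S(3,2)] m_sym[OF S(2,3)] by simp
  qed
  have "legal (\<lambda>_. 1) (t # w)" using w S by simp
  then have "legal (\<lambda>_. 1) (s # ?p' @ p1)" using legal_braid_eq tws by blast
  then have "reduced (s # ?p' @ p1)" using reduced_iff_legal_one legal_lists by blast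
  moreover have "s # ?p' @ p1 \<doteq> u # ?q' @ q1" using tws twu braid_eq_trans braid_eq_sym by blast
  ultimately obtain e where e: "?p' @ p1 \<doteq> alt u s (m s u - 1) @ e" "?q' @ q1 \<doteq> alt s u (m s u - 1) @ e"
    using reduced_two_heads by blast
  have "a \<doteq> (?p' @ p1) @ z" using braid_eq_trans[OF e1(1)] braid_eq_append[OF braid_eq_refl e1'] by simp
  also have "\<dots> \<doteq> alt u s (m s u - 1) @ e @ z" using braid_eq_append[OF e(1) braid_eq_refl] by simp
  finally have "a \<doteq> alt u s (m s u - 1) @ e @ z" .
  moreover have "c \<doteq> (?q' @ q1) @ z" using braid_eq_trans[OF e2(2)] braid_eq_append[OF braid_eq_refl e2'] by simp
  then have "c \<doteq> alt s u (m s u - 1) @ e @ z"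
    using braid_eq_trans braid_eq_append[OF e(2) braid_eq_refl, of z] by simp
  ultimately show ?thesis unfolding factors_through_lcm_def by blast
qed

lemma reduction_upto: "reduction_upto n"
proof (induction n)
  case (Suc n)
  \<comment> \<open>Inner induction along the chain of braid moves; the bound \<open>n\<close>
    suffices because moves preserve length.\<close>
  have "\<exists>t b. y = t # b \<and> t \<in> S \<and> factors_through_lcm s a t b"
    if s: "s \<in> S" and eq: "s # a \<doteq> y" and n: "length a \<le> n" for s a y
    using eq unfolding braid_eq_def
  proof (induction rule: rtranclp_induct)
    case base
    then show ?case using s m_diag unfolding factors_through_lcm_def by auto
  next
    case (step y z)
    then obtain t b where y: "y = t # b" "t \<in> S" "factors_through_lcm s a t b" by blast
    then obtain u c where z: "z = u # c" "u \<in> S" "factors_through_lcm t b u c"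
      using factors_through_lcm_braid_step step.hyps(2) by metis
    have "length b = length a" using braid_eq_length[of "s # a" y] step.hyps(1) y by (simp add: braid_eq_def)
    then show ?case using factors_through_lcm_trans[OF Suc s y(2) z(2) y(3) z(3)] z n by auto
  qed
  then show ?case unfolding reduction_upto_def by (metis less_Suc_eq_le list.inject)
qed (simp add: reduction_upto_def)

lemma reduction:
  assumes "s # a \<doteq> t # b" "s \<in> S" "t \<in> S"
  obtains e where "a \<doteq> alt t s (m s t - 1) @ e" "b \<doteq> alt s t (m s t - 1) @ e"
  using reduction_uptoD[OF reduction_upto assms lessI] unfolding factors_through_lcm_def by blast

lemma cancel_left: "u @ a \<doteq> u @ b \<Longrightarrow> u \<in> lists S \<Longrightarrow> a \<doteq> b"
  using cancel_upto[OF reduction_upto] by blast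

lemma join:
  assumes "legal g p" "legal g q" "p @ x \<doteq> q @ y"
  obtains w p' q' z where "legal g w" "w \<doteq> p @ p'" "w \<doteq> q @ q'" "w @ z \<doteq> p @ x"
  using join_upto[OF reduction_upto assms order_refl] by blast

end

section \<open>Generators as left divisors, and divisibility by powers\<close>

context coxeter_system
begin

lemma reduced_tail:
  assumes "reduced (s # w)" shows "reduced w"
  unfolding reduced_def
proof (intro conjI allI impI)
  show w: "w \<in> lists S" using assms by (simp add: reduced_def)
  fix v assume "weq w v"
  then have "weq (s # w) (s # v)"
    using weq_context[of w v "[s]" "[]"] assms by (simp add: reduced_def)
  then show "length w \<le> length v" using assms unfolding reduced_def by fastforce
qed

text \<open>Decided by the sign of the value at \<open>s\<close> at the start of the game for
  \<open>w\<close>; the value is never zero.\<close>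

lemma head_or_extend:
  assumes w: "reduced w" and s: "s \<in> S"
  shows "(\<exists>e. w \<doteq> s # e) \<or> reduced (s # w)"
proof -
  let ?g = "run (\<lambda>_. -1) (rev w)"
  have wS: "w \<in> lists S" using w by (simp add: reduced_def)
  have pl: "play ?g w" using reduced_iff_play[of "\<lambda>_. -1", OF _ wS] w by simp
  show ?thesis
  proof (cases "0 < ?g s")
    case True
    then have "legal ?g [s]" using s by simp
    then obtain v where "w \<doteq> [s] @ v" using play_extend pl by blast
    then show ?thesis by auto
  next
    case False
    then have "play (act s ?g) (s # w)" using play_nonzero[OF pl s] pl s by (simp add: play_Cons act_self)
    then show ?thesis using reduced_iff_play[of "\<lambda>_. -1" "s # w"] wS s by simp
  qed
qed

text \<open>When every generator is a left divisor of \<open>w\<close>, the point from which \<open>w\<close> is played lies in the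
  open fundamental chamber, so that every reduced word is legal there.\<close>
lemma all_heads_extend:
  assumes w: "reduced w" and heads: "\<forall>s\<in>S. \<exists>e. w \<doteq> s # e" and v: "reduced v"
  obtains v' where "w \<doteq> v @ v'"
proof -
  let ?g = "run (\<lambda>_. -1) (rev w)"
  have wS: "w \<in> lists S" using w by (simp add: reduced_def)
  have pl: "play ?g w" using reduced_iff_play[of "\<lambda>_. -1", OF _ wS] w by simp
  have "\<forall>s\<in>S. 0 < ?g s" using heads play_braid_eq pl play_Cons by metis
  then have "legal ?g v" using reduced_iff_legal[of ?g v] v unfolding reduced_def by blast
  then show thesis using play_extend pl that by blast
qed

text \<open>A move between distinct letters needs both of them in the word, since then
  \<open>m p q\<close> is at least 2.\<close>

lemma replicate_braid_eq:
  assumes "replicate k s \<doteq> u" shows "u = replicate k s"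
  using assms unfolding braid_eq_def
proof (induction rule: rtranclp_induct)
  case (step v w)
  then obtain x y p q where pq: "p \<in> S" "q \<in> S"
    and vw: "v = x @ alt p q (m p q) @ y" "w = x @ alt q p (m p q) @ y"
    unfolding braid_step_def by blast
  have sub: "set v \<subseteq> {s}" using step.IH by auto
  have "p = q"
  proof (rule ccontr)
    assume ne: "p \<noteq> q"
    then obtain n where "m p q = Suc (Suc n)" using m_ge_2[OF pq ne] by (metis add_2_eq_Suc le_Suc_ex)
    then have "{p, q} \<subseteq> set v" using vw by simp
    then show False using ne sub by auto
  qed
  then show ?case using vw step.IH by simp
qed simp

text \<open>Each use of \<open>reduction\<close> strips one \<open>s\<close>, and \<open>r\<close>
  still divides what remains because \<open>m s r - 1\<close> is positive.\<close>

lemma power_divisible: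
  assumes rs: "r \<in> S" "s \<in> S" "r \<noteq> s" and "0 < k" and "replicate k s @ x \<doteq> r # y"
  shows "\<exists>e. x \<doteq> alt r s (m r s - 1) @ e"
  using assms(4,5)
proof (induction k arbitrary: y)
  case (Suc k)
  then have eq: "s # (replicate k s @ x) \<doteq> r # y" by simp
  obtain e where e: "replicate k s @ x \<doteq> alt r s (m s r - 1) @ e"
    by (rule reduction[OF eq rs(2,1)])
  show ?case
  proof (cases "k = 0")
    case True
    then show ?thesis using e m_sym[OF rs(1,2)] by auto
  next
    case False
    obtain n where "m s r - 1 = Suc n"
      using m_ge_2[OF rs(2,1)] rs(3) by (cases "m s r - 1") auto
    then have "replicate k s @ x \<doteq> r # (alt s r n @ e)" using e by simp
    then show ?thesis using Suc.IH False by blast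
  qed
qed simp

text \<open>Write \<open>g = r g'\<close>. Since \<open>r\<close> and \<open>s\<^sup>k\<close> both divide \<open>g t\<^sup>k\<close>, the letter \<open>s\<close> divides \<open>g'\<close>;
  then the roles of \<open>r\<close> and \<open>s\<close> are exchanged for \<open>g'\<close>, and \<open>g\<close> becomes divisible by \<open>lcm(r, s)\<close>.\<close>
lemma head_propagates:
  assumes rs: "r \<in> S" "s \<in> S" "r \<noteq> s" and m: "m r s \<noteq> 2"
    and r: "g \<doteq> r # g'"
    and s_comm: "replicate k s @ g \<doteq> g @ replicate k t" "0 < k"
    and r_comm: "replicate l r @ g \<doteq> g @ replicate l u" "0 < l"
  shows "\<exists>e. g \<doteq> s # e"
proof -
  have "replicate k s @ g \<doteq> r # (g' @ replicate k t)"
    using braid_eq_trans[OF s_comm(1)] braid_eq_append[OF r braid_eq_refl] by simp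
  then obtain e where e: "g \<doteq> alt r s (m r s - 1) @ e" using power_divisible[OF rs s_comm(2)] by blast
  \<comment> \<open>With \<open>m r s\<close> at least 3, the divisor
    \<open>alt r s (m r s - 1)\<close> begins with \<open>r\<close> and then \<open>s\<close>, so
    \<open>g2\<close> starts with \<open>s\<close>.\<close>
  define n where "n = m r s - 3"
  define g2 where "g2 = s # alt r s n @ e"
  have n: "m r s = Suc (Suc (Suc n))" using m_ge_2[OF rs] m by (simp add: n_def)
  have g2: "g \<doteq> r # g2" using e n by (simp add: g2_def)
  have "r # (replicate l r @ g2) = replicate l r @ r # g2" by (simp add: replicate_app_Cons_same)
  also have "\<dots> \<doteq> replicate l r @ g" by (intro braid_eq_append braid_eq_refl braid_eq_sym[OF g2])
  also have "\<dots> \<doteq> g @ replicate l u" by (rule r_comm)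
  also have "\<dots> \<doteq> (r # g2) @ replicate l u" by (intro braid_eq_append braid_eq_refl g2)
  finally have "[r] @ (replicate l r @ g2) \<doteq> [r] @ (g2 @ replicate l u)" by simp
  then have "replicate l r @ g2 \<doteq> g2 @ replicate l u" using cancel_left rs by (metis lists.Cons lists.Nil)
  then have "replicate l r @ g2 \<doteq> s # (alt r s n @ e @ replicate l u)" by (simp add: g2_def)
  then obtain e2 where e2: "g2 \<doteq> alt s r (m s r - 1) @ e2"
    using power_divisible[OF rs(2,1) rs(3)[symmetric] r_comm(2)] by blast
  have "g \<doteq> r # alt s r (m s r - 1) @ e2" by (rule braid_eq_trans[OF g2 braid_eq_Cons[OF e2]])
  also have "\<dots> = alt r s (m r s) @ e2" using alt_m_Cons[OF rs(1,2)] m_sym[OF rs(1,2)] by simp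
  also have "\<dots> \<doteq> alt s r (m r s) @ e2" by (rule braid_eq_alt[OF rs(1,2)])
  finally show ?thesis using n by auto
qed

end

section \<open>The Garside element\<close>

locale coxeter_longest = coxeter_system +
  fixes D
  assumes reduced_D: "reduced D"
    and longest_D: "reduced w \<Longrightarrow> length w \<le> length D"
begin

lemma D_lists: "D \<in> lists S"
  using reduced_D by (simp add: reduced_def)

lemma all_heads_D:
  assumes "reduced w" "\<forall>s\<in>S. \<exists>e. w \<doteq> s # e"
  shows "w \<doteq> D"
proof -
  obtain v where v: "w \<doteq> D @ v" by (rule all_heads_extend[OF assms reduced_D])
  then have "v = []" using braid_eq_length[OF v] longest_D[OF assms(1)] by simp
  then show ?thesis using v by simp
qed

text \<open>No generator can be prepended to a reduced word of maximal length, so all of them divide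
  it.\<close>

lemma longest_unique:
  assumes "reduced w" "length w = length D"
  shows "w \<doteq> D"
proof (rule all_heads_D[OF assms(1)], rule)
  fix s assume s: "s \<in> S"
  have "\<not> reduced (s # w)" using longest_D[of "s # w"] assms by auto
  then show "\<exists>e. w \<doteq> s # e" using head_or_extend[OF assms(1) s] by blast
qed

lemma head_D:
  assumes "s \<in> S" obtains e where "D \<doteq> s # e"
  using head_or_extend[OF reduced_D assms] longest_D[of "s # D"] by auto

lemma rev_D: "rev D \<doteq> D"
  by (rule longest_unique) (simp_all add: reduced_rev reduced_D)

text \<open>Take a longest reduced left divisor \<open>w\<close> of \<open>y\<close>. By
  \<open>join\<close>, \<open>w\<close> and a generator have a common reduced multiple that still
  divides \<open>y\<close>; by maximality it is \<open>w\<close>, so every generator divides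
  \<open>w\<close>.\<close>

lemma D_divides:
  assumes "\<forall>s\<in>S. \<exists>e. y \<doteq> s # e"
  shows "\<exists>e. y \<doteq> D @ e"
proof -
  let ?P = "\<lambda>w. reduced w \<and> (\<exists>e. y \<doteq> w @ e)"
  have "?P []" by (auto simp: reduced_iff_legal_one)
  moreover have "\<forall>w. ?P w \<longrightarrow> length w < Suc (length y)"
    by (auto dest: braid_eq_length)
  ultimately obtain w where "?P w" and max: "\<And>w'. ?P w' \<Longrightarrow> length w' \<le> length w"
    using ex_has_greatest_nat[of ?P "[]" length "Suc (length y)"] by blast
  then obtain e where w: "reduced w" and e: "y \<doteq> w @ e" by blast
  have "\<exists>c. w \<doteq> s # c" if s: "s \<in> S" for s
  proof -
    obtain e' where e': "y \<doteq> s # e'" using assms s by blast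
    have "legal (\<lambda>_. 1) w" using w reduced_iff_legal_one unfolding reduced_def by blast
    moreover have "legal (\<lambda>_. 1) [s]" using s by simp
    moreover have "w @ e \<doteq> [s] @ e'" using braid_eq_trans[OF braid_eq_sym[OF e] e'] by simp
    ultimately obtain w' p q z where j: "legal (\<lambda>_. 1) w'" "w' \<doteq> w @ p" "w' \<doteq> [s] @ q" "w' @ z \<doteq> w @ e"
      by (rule join)
    have "reduced w'" using j(1) reduced_iff_legal_one legal_lists by blast
    moreover have "y \<doteq> w' @ z" using braid_eq_trans[OF e braid_eq_sym[OF j(4)]] .
    ultimately have "length w' \<le> length w" using max by blast
    then have "p = []" using braid_eq_length[OF j(2)] by simp
    then have "w \<doteq> [s] @ q" using braid_eq_trans[OF braid_eq_sym j(3)] j(2) by simp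
    then show ?thesis by auto
  qed
  then have "w \<doteq> D" using all_heads_D[OF w] by blast
  then show ?thesis using braid_eq_trans[OF e braid_eq_append[OF _ braid_eq_refl]] by blast
qed

text \<open>Split off \<open>s\<close> from \<open>D\<close>, leaving \<open>e\<close>. Some
  \<open>t\<close> prolongs \<open>e\<close> on the right, and \<open>e @ [t]\<close> is again
  longest, hence \<open>D\<close>. Reversing the first relation gives the second, as
  \<open>D\<close> is its own reversal.\<close>

lemma D_swap:
  assumes s: "s \<in> S"
  obtains t where "t \<in> S" "s # D \<doteq> D @ [t]" "t # D \<doteq> D @ [s]"
proof -
  obtain e where e: "D \<doteq> s # e" using head_D s by blast
  have re: "reduced (rev e)" using reduced_braid_eq[OF e reduced_D] reduced_tail reduced_rev by blast
  have len: "length D = Suc (length e)" using braid_eq_length[OF e] by simp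
  obtain t where t: "t \<in> S" "reduced (t # rev e)"
  proof (rule ccontr)
    assume "\<not> thesis"
    then have "\<forall>t\<in>S. \<exists>c. rev e \<doteq> t # c" using head_or_extend[OF re] that by blast
    then have "rev e \<doteq> D" by (rule all_heads_D[OF re])
    then show False using braid_eq_length[of "rev e" D] len by simp
  qed
  have "e @ [t] \<doteq> D" using longest_unique[of "e @ [t]"] reduced_rev[OF t(2)] len by simp
  have "s # D \<doteq> s # e @ [t]" by (intro braid_eq_Cons braid_eq_sym[OF \<open>e @ [t] \<doteq> D\<close>])
  also have "\<dots> \<doteq> D @ [t]" using braid_eq_append[OF braid_eq_sym[OF e] braid_eq_refl] by simp
  finally have 1: "s # D \<doteq> D @ [t]" .
  have "t # D \<doteq> t # rev D" by (intro braid_eq_Cons braid_eq_sym[OF rev_D])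
  also have "\<dots> \<doteq> rev D @ [s]" using braid_eq_sym[OF braid_eq_rev[OF 1]] by simp
  also have "\<dots> \<doteq> D @ [s]" by (intro braid_eq_append rev_D braid_eq_refl)
  finally show thesis using that t(1) 1 by blast
qed

lemma replicate_swap:
  assumes "s # D \<doteq> D @ [t]"
  shows "replicate k s @ D \<doteq> D @ replicate k t"
proof (induction k)
  case (Suc k)
  have "replicate (Suc k) s @ D \<doteq> s # D @ replicate k t" using braid_eq_Cons[OF Suc] by simp
  also have "\<dots> \<doteq> (D @ [t]) @ replicate k t" using braid_eq_append[OF assms braid_eq_refl] by simp
  finally show ?case by simp
qed simp

lemma D_square_central:
  assumes "x \<in> lists S" shows "x @ D @ D \<doteq> D @ D @ x"
  using assms
proof (induction x)
  case (Cons s x)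
  then have "s \<in> S" by simp
  then obtain t where t: "s # D \<doteq> D @ [t]" "t # D \<doteq> D @ [s]" by (rule D_swap)
  have "(s # x) @ D @ D \<doteq> s # D @ D @ x" using Cons braid_eq_Cons by simp
  also have "\<dots> \<doteq> (D @ [t]) @ D @ x" using braid_eq_append[OF t(1) braid_eq_refl] by simp
  also have "\<dots> = D @ (t # D) @ x" by simp
  also have "\<dots> \<doteq> D @ (D @ [s]) @ x" by (intro braid_eq_append braid_eq_refl t)
  finally show ?case by simp
qed simp

definition full_twists :: "nat \<Rightarrow> 'a list" where
  "full_twists n = concat (replicate n (D @ D))"

lemma full_twists_add: "full_twists (i + j) = full_twists i @ full_twists j"
  by (simp add: full_twists_def replicate_add)

lemma full_twists_lists: "full_twists n \<in> lists S"
  unfolding full_twists_def using D_lists by (induction n) auto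

lemma full_twists_central: "x \<in> lists S \<Longrightarrow> x @ full_twists n \<doteq> full_twists n @ x"
proof (induction n)
  case (Suc n)
  have "x @ full_twists (Suc n) = (x @ D @ D) @ full_twists n" by (simp add: full_twists_def)
  also have "\<dots> \<doteq> (D @ D @ x) @ full_twists n" by (intro braid_eq_append braid_eq_refl D_square_central Suc.prems)
  also have "\<dots> = (D @ D) @ x @ full_twists n" by simp
  also have "\<dots> \<doteq> (D @ D) @ full_twists n @ x" by (intro braid_eq_append braid_eq_refl Suc)
  finally show ?case by (simp add: full_twists_def)
qed (simp add: full_twists_def)

text \<open>Comparing lengths gives \<open>i = j\<close>, unless \<open>D\<close> is empty and all
  twists are trivial.\<close>

lemma full_twists_cancel:
  assumes "u @ full_twists i \<doteq> v @ full_twists j" "length u = length v" and S: "u \<in> lists S" "v \<in> lists S"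
  shows "u \<doteq> v"
proof -
  have l: "length (full_twists n) = n * (2 * length D)" for n
    by (induction n) (auto simp: full_twists_def)
  have "length (full_twists i) = length (full_twists j)" using braid_eq_length[OF assms(1)] assms(2) by simp
  then have "D = [] \<or> i = j" unfolding l by auto
  then have "full_twists i = full_twists j" unfolding full_twists_def by auto
  then have "full_twists i @ u \<doteq> full_twists i @ v"
    using assms(1) full_twists_central[OF S(1), of i] full_twists_central[OF S(2), of i] braid_eq_trans braid_eq_sym by metis
  then show ?thesis using cancel_left full_twists_lists by blast
qed

text \<open>By \<open>head_propagates\<close> and irreducibility the set of left divisors of \<open>g\<close> in \<open>S\<close> is empty or all of
  \<open>S\<close>; in the second case a factor \<open>\<Delta>\<close> splits off.\<close>
lemma power_of_D:
  assumes irr: "irreducible_coxeter S m" and "g \<in> lists S"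
    and "\<forall>s\<in>S. \<exists>k t. 0 < k \<and> replicate k s @ g \<doteq> g @ replicate k t"
  shows "\<exists>n. g \<doteq> concat (replicate n D)"
  using assms(2,3)
proof (induction "length g" arbitrary: g rule: less_induct)
  case less
  show ?case
  proof (cases g)
    case Nil
    then show ?thesis by (intro exI[of _ 0]) simp
  next
    case (Cons s0 g')
    then have s0: "s0 \<in> S" using less.prems(1) by simp
    define I where "I = {s \<in> S. \<exists>e. g \<doteq> s # e}"
    have "s0 \<in> I" using s0 Cons by (auto simp: I_def)
    have "I \<subseteq> S" by (auto simp: I_def)
    have "I = S"
    proof (rule ccontr)
      assume ne: "I \<noteq> S"
      have "I \<noteq> {}" "S - I \<noteq> {}" "I \<union> (S - I) = S" "I \<inter> (S - I) = {}"
        using ne \<open>s0 \<in> I\<close> \<open>I \<subseteq> S\<close> by blast+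
      note partition = this
      obtain r s where rs: "r \<in> I" "s \<in> S - I" "m r s \<noteq> 2"
      proof (rule ccontr)
        assume "\<not> thesis"
        then have "\<forall>r\<in>I. \<forall>s\<in>S - I. m r s = 2" using that by metis
        then have "\<exists>S1 S2. S1 \<noteq> {} \<and> S2 \<noteq> {} \<and> S1 \<union> S2 = S \<and> S1 \<inter> S2 = {} \<and>
            (\<forall>r\<in>S1. \<forall>s\<in>S2. m r s = 2)"
          by (intro exI[of _ I] exI[of _ "S - I"] conjI partition)
        then show False using irr unfolding irreducible_coxeter_def by (rule notE[rotated])
      qed
      then have r: "r \<in> S" and s: "s \<in> S" and ne: "r \<noteq> s" using \<open>I \<subseteq> S\<close> by blast+
      obtain e where "g \<doteq> r # e" using rs(1) unfolding I_def by blast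
      moreover obtain k t where "0 < k" "replicate k s @ g \<doteq> g @ replicate k t" using less.prems(2) s by blast
      moreover obtain l u where "0 < l" "replicate l r @ g \<doteq> g @ replicate l u" using less.prems(2) r by blast
      ultimately have "\<exists>e. g \<doteq> s # e" using head_propagates[OF r s ne rs(3)] by blast
      then show False using rs(2) s unfolding I_def by blast
    qed
    then have "\<forall>s\<in>S. \<exists>e. g \<doteq> s # e" unfolding I_def by blast
    then obtain g1 where g1: "g \<doteq> D @ g1" using D_divides by blast
    obtain e0 where "D \<doteq> s0 # e0" using head_D[OF s0] .
    then have "length g1 < length g" using braid_eq_length[OF g1] by (auto dest: braid_eq_length)
    moreover have "g1 \<in> lists S" using braid_eq_lists[OF g1 less.prems(1)] by simp
    moreover have "\<exists>k t. 0 < k \<and> replicate k s @ g1 \<doteq> g1 @ replicate k t" if s: "s \<in> S" for s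
    proof -
      \<comment> \<open>Removing \<open>D\<close> permutes the generators on the left but not on the
        right. This is why the hypothesis lets \<open>t\<close> differ from
        \<open>s\<close>.\<close>
      obtain s' where s': "s' \<in> S" "s' # D \<doteq> D @ [s]" using D_swap[OF s] by metis
      obtain k t where k: "0 < k" "replicate k s' @ g \<doteq> g @ replicate k t" using less.prems(2) s' by blast
      have "D @ replicate k s @ g1 \<doteq> (replicate k s' @ D) @ g1"
        using braid_eq_append[OF braid_eq_sym[OF replicate_swap[OF s'(2), of k]] braid_eq_refl] by simp
      also have "\<dots> = replicate k s' @ (D @ g1)" by simp
      also have "\<dots> \<doteq> replicate k s' @ g" by (intro braid_eq_append braid_eq_refl braid_eq_sym[OF g1])
      also have "\<dots> \<doteq> g @ replicate k t" by (rule k(2))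
      also have "\<dots> \<doteq> (D @ g1) @ replicate k t" by (intro braid_eq_append braid_eq_refl g1)
      finally have "D @ replicate k s @ g1 \<doteq> D @ g1 @ replicate k t" by simp
      then show ?thesis using cancel_left D_lists k(1) by blast
    qed
    ultimately obtain n where n: "g1 \<doteq> concat (replicate n D)" using less.hyps by blast
    have "g \<doteq> concat (replicate (Suc n) D)"
      using braid_eq_trans[OF g1 braid_eq_append[OF braid_eq_refl n]] by simp
    then show ?thesis ..
  qed
qed

end

section \<open>Presented groups and finite conjugation orbits\<close>

lemma (in group) finite_orbit_commuting_power:
  assumes fin: "finite (conj_orbit G g)" and a: "a \<in> carrier G" and g: "g \<in> carrier G"
  shows "\<exists>k>0. a [^] (k::nat) \<otimes> g = g \<otimes> a [^] k"
proof -
  let ?h = "\<lambda>i::nat. a [^] i \<otimes> g \<otimes> inv (a [^] i)"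
  have "range ?h \<subseteq> conj_orbit G g" using a unfolding conj_orbit_def by blast
  then have "finite (range ?h)" using fin finite_subset by blast
  then have "\<not> inj ?h" using finite_imageD infinite_UNIV_nat by blast
  then obtain i j where "?h i = ?h j" "i \<noteq> j" unfolding inj_def by blast
  then obtain i j where eq: "?h i = ?h j" and ij: "i < j" by (metis (no_types) nat_neq_iff)
  define k where "k = j - i"
  have j: "a [^] j = a [^] i \<otimes> a [^] k" using ij a by (simp add: k_def nat_pow_mult)
  define p q where "p = a [^] i" and "q = a [^] k"
  have pq: "p \<in> carrier G" "q \<in> carrier G" using a by (simp_all add: p_def q_def)
  have "p \<otimes> g \<otimes> inv p = p \<otimes> (q \<otimes> g \<otimes> inv q) \<otimes> inv p"
    using eq pq g unfolding j p_def[symmetric] q_def[symmetric] by (simp add: inv_mult_group m_assoc)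
  then have "g = q \<otimes> g \<otimes> inv q" using pq g by simp
  then have "g \<otimes> q = q \<otimes> g" using pq g by (metis inv_solve_right m_closed)
  then show ?thesis using ij unfolding q_def k_def by (metis zero_less_diff)
qed

text \<open>As \<open>H\<close> commutes with \<open>z\<close>, the conjugate of \<open>z\<close> by
  \<open>h\<close> depends only on the coset \<open>H #> inv h\<close>.\<close>

lemma (in group) finite_index_centralizer_finite_orbit:
  assumes H: "subgroup H G" and fin: "finite (rcosets H)" and z: "z \<in> center_of G H"
  shows "finite (conj_orbit G z)"
proof -
  have zH: "z \<in> carrier G" using z H subgroup.subset unfolding center_of_def by blast
  define c where "c C = (SOME k. k \<in> C)" for C :: "'a set"
  have "conj_orbit G z \<subseteq> (\<lambda>C. inv (c C) \<otimes> z \<otimes> c C) ` (rcosets H)"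
  proof
    fix y assume "y \<in> conj_orbit G z"
    then obtain h where h: "h \<in> carrier G" "y = h \<otimes> z \<otimes> inv h" unfolding conj_orbit_def by blast
    let ?C = "H #> inv h"
    have C: "?C \<in> rcosets H" using h by (simp add: RCOSETS_def) blast
    have "inv h \<in> ?C" using H h by (simp add: rcos_self)
    then have "c ?C \<in> ?C" unfolding c_def by (rule someI)
    then obtain a where a: "a \<in> H" "c ?C = a \<otimes> inv h" unfolding r_coset_def by blast
    have aG: "a \<in> carrier G" using a H subgroup.subset by blast
    have "z \<otimes> a = a \<otimes> z" using z a unfolding center_of_def by blast
    then have "inv a \<otimes> z \<otimes> a = z" using aG zH by (simp add: m_assoc flip: m_assoc[of "inv a" a z])
    moreover have "inv (c ?C) \<otimes> z \<otimes> c ?C = h \<otimes> (inv a \<otimes> z \<otimes> a) \<otimes> inv h"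
      using a aG h zH by (simp add: inv_mult_group m_assoc)
    ultimately have "inv (c ?C) \<otimes> z \<otimes> c ?C = y" using h by simp
    then show "y \<in> (\<lambda>C. inv (c C) \<otimes> z \<otimes> c C) ` (rcosets H)" using C by blast
  qed
  then show ?thesis using fin finite_subset by blast
qed

lemma (in group) conj_orbit_central:
  assumes "g \<in> center_of G (carrier G)"
  shows "conj_orbit G g = {g}"
proof -
  have g: "g \<in> carrier G" and c: "\<And>h. h \<in> carrier G \<Longrightarrow> g \<otimes> h = h \<otimes> g"
    using assms unfolding center_of_def by blast+
  have "h \<otimes> g \<otimes> inv h = g" if "h \<in> carrier G" for h
    using c[OF that] g that by (metis inv_solve_right' m_closed)
  then have "conj_orbit G g = (\<lambda>_. g) ` carrier G"
    unfolding conj_orbit_def Setcompr_eq_image by (intro image_cong) auto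
  then show ?thesis using one_closed by auto
qed

section \<open>Groups given by generators and relations\<close>

locale presentation =
  fixes S :: "'a set" and R :: "('a word \<times> 'a word) set"
  assumes R_lists: "R \<subseteq> lists (S \<times> UNIV) \<times> lists (S \<times> UNIV)"
begin

abbreviation cl :: "'a word \<Rightarrow> 'a word set" where
  "cl \<equiv> word_class S R"

lemma mem_cl: "q \<in> cl p \<longleftrightarrow> (p, q) \<in> pres_eq S R"
  by (simp add: word_class_def)

lemma cl_eq_iff:
  assumes "p \<in> lists (S \<times> UNIV)"
  shows "cl p = cl q \<longleftrightarrow> (p, q) \<in> pres_eq S R"
proof
  assume "cl p = cl q"
  then show "(p, q) \<in> pres_eq S R" using mem_cl pres_eq.refl pres_eq.sym assms by metis
next
  assume "(p, q) \<in> pres_eq S R"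
  then show "cl p = cl q" unfolding set_eq_iff mem_cl using pres_eq.trans pres_eq.sym by metis
qed

lemma carrier_eq: "carrier (presented_group S R) = cl ` lists (S \<times> UNIV)"
  by (auto simp: presented_group_def quotient_def word_class_def)

lemma one_eq: "\<one>\<^bsub>presented_group S R\<^esub> = cl []"
  by (simp add: presented_group_def)

lemma pres_eq_append:
  assumes "(p, p') \<in> pres_eq S R" "(q, q') \<in> pres_eq S R"
  shows "(p @ q, p' @ q') \<in> pres_eq S R"
proof (rule pres_eq.trans)
  show "(p @ q, p' @ q) \<in> pres_eq S R"
    using pres_eq.ctx[OF assms(1), of "[]" q] pres_eq_lists[OF assms(2) R_lists] by simp
  show "(p' @ q, p' @ q') \<in> pres_eq S R"
    using pres_eq.ctx[OF assms(2), of p' "[]"] pres_eq_lists[OF assms(1) R_lists] by simp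
qed

text \<open>Independence of the representatives picked by \<open>SOME\<close> in the
  multiplication.\<close>

lemma mult_eq:
  assumes "p \<in> lists (S \<times> UNIV)" "q \<in> lists (S \<times> UNIV)"
  shows "cl p \<otimes>\<^bsub>presented_group S R\<^esub> cl q = cl (p @ q)"
proof -
  have "(SOME r. r \<in> cl p) \<in> cl p" "(SOME r. r \<in> cl q) \<in> cl q"
    using assms by (auto simp: mem_cl intro: someI pres_eq.refl)
  then have "(p @ q, (SOME r. r \<in> cl p) @ (SOME r. r \<in> cl q)) \<in> pres_eq S R"
    unfolding mem_cl by (rule pres_eq_append)
  then have "cl (p @ q) = cl ((SOME r. r \<in> cl p) @ (SOME r. r \<in> cl q))"
    using cl_eq_iff assms by simp
  then show ?thesis by (simp add: presented_group_def)
qed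

lemma left_inverse:
  "p \<in> lists (S \<times> UNIV) \<Longrightarrow> (rev (map (\<lambda>(x, b). (x, \<not> b)) p) @ p, []) \<in> pres_eq S R"
proof (induction p)
  case (Cons a p)
  obtain x b where a: "a = (x, b)" by fastforce
  let ?q = "rev (map (\<lambda>(x, b). (x, \<not> b)) p)"
  have p: "p \<in> lists (S \<times> UNIV)" "?q \<in> lists (S \<times> UNIV)" "x \<in> S" using Cons.prems a by auto
  have "([(x, \<not> b), (x, b)], []) \<in> pres_eq S R" using pres_eq.cancel[of x S "\<not> b"] p by simp
  from pres_eq.trans[OF pres_eq.ctx[OF this p(2,1)]] show ?case using Cons.IH[OF p(1)] a by simp
qed (auto intro: pres_eq.refl)

lemma group_presented: "group (presented_group S R)"
proof (rule groupI)
  let ?G = "presented_group S R"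
  show "\<one>\<^bsub>?G\<^esub> \<in> carrier ?G" by (auto simp: one_eq carrier_eq)
  show "x \<otimes>\<^bsub>?G\<^esub> y \<in> carrier ?G" if "x \<in> carrier ?G" "y \<in> carrier ?G" for x y
    using that unfolding carrier_eq by (elim imageE) (simp add: mult_eq)
  show "x \<otimes>\<^bsub>?G\<^esub> y \<otimes>\<^bsub>?G\<^esub> z = x \<otimes>\<^bsub>?G\<^esub> (y \<otimes>\<^bsub>?G\<^esub> z)"
    if "x \<in> carrier ?G" "y \<in> carrier ?G" "z \<in> carrier ?G" for x y z
    using that unfolding carrier_eq by (elim imageE) (simp add: mult_eq)
  show "\<one>\<^bsub>?G\<^esub> \<otimes>\<^bsub>?G\<^esub> x = x" if "x \<in> carrier ?G" for x
    using that unfolding carrier_eq by (elim imageE) (simp add: mult_eq one_eq)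
  show "\<exists>y\<in>carrier ?G. y \<otimes>\<^bsub>?G\<^esub> x = \<one>\<^bsub>?G\<^esub>" if x: "x \<in> carrier ?G" for x
  proof -
    obtain p where p: "x = cl p" "p \<in> lists (S \<times> UNIV)" using x by (auto simp: carrier_eq)
    let ?q = "rev (map (\<lambda>(x, b). (x, \<not> b)) p)"
    have q: "?q \<in> lists (S \<times> UNIV)" using p by auto
    have "cl ?q \<otimes>\<^bsub>?G\<^esub> x = \<one>\<^bsub>?G\<^esub>"
      using left_inverse[OF p(2)] cl_eq_iff[of "?q @ p"] mult_eq[OF q p(2)] p q by (simp add: one_eq)
    then show ?thesis using q by (auto simp: carrier_eq)
  qed
qed

lemma cl_pow:
  assumes "p \<in> lists (S \<times> UNIV)"
  shows "cl p [^]\<^bsub>presented_group S R\<^esub> (k::nat) = cl (concat (replicate k p))"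
proof -
  interpret group "presented_group S R" by (rule group_presented)
  have "concat (replicate k p) \<in> lists (S \<times> UNIV)" for k using assms by (induction k) auto
  then show ?thesis
    by (induction k) (use assms in \<open>simp_all add: one_eq mult_eq replicate_append_same[symmetric]\<close>)
qed

text \<open>Commutation with an inverse letter follows by inserting \<open>s\<close> with its
  inverse on the left of \<open>g\<close> and cancelling on the right.\<close>

lemma central_if_commutes_with_letters:
  assumes g: "g \<in> lists (S \<times> UNIV)"
    and comm: "\<And>s. s \<in> S \<Longrightarrow> (g @ [(s, True)], (s, True) # g) \<in> pres_eq S R"
  shows "cl g \<in> center_of (presented_group S R) (carrier (presented_group S R))"
proof -
  interpret group "presented_group S R" by (rule group_presented)
  have letter: "(g @ [(s, b)], (s, b) # g) \<in> pres_eq S R" if s: "s \<in> S" for s b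
  proof (cases b)
    case False
    let ?s = "[(s, True)]" and ?i = "[(s, False)]"
    have S: "?s \<in> lists (S \<times> UNIV)" "?i \<in> lists (S \<times> UNIV)" using s by auto
    have i: "(?i @ ?s, []) \<in> pres_eq S R" "(?s @ ?i, []) \<in> pres_eq S R"
      using pres_eq.cancel[OF s, of False R] pres_eq.cancel[OF s, of True R] by simp_all
    have "(g @ ?i, ?i @ (?s @ g) @ ?i) \<in> pres_eq S R"
      using pres_eq.sym[OF pres_eq.ctx[OF i(1), of "[]" "g @ ?i"]] g S by simp
    also have "(?i @ (?s @ g) @ ?i, (?i @ g) @ (?s @ ?i)) \<in> pres_eq S R"
      using pres_eq.ctx[OF pres_eq.sym[OF comm[OF s]] S(2) S(2)] by simp
    also (pres_eq.trans) have "((?i @ g) @ (?s @ ?i), ?i @ g) \<in> pres_eq S R"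
      using pres_eq.ctx[OF i(2), of "?i @ g" "[]"] g S by simp
    finally (pres_eq.trans) show ?thesis using False by simp
  qed (use comm[OF s] in simp)
  have word: "(g @ p, p @ g) \<in> pres_eq S R" if "p \<in> lists (S \<times> UNIV)" for p
    using that
  proof (induction p rule: list.induct)
    case (Cons a p)
    obtain s b where a: "a = (s, b)" "s \<in> S" using Cons.prems by auto
    have p: "p \<in> lists (S \<times> UNIV)" using Cons.prems by simp
    have "(g @ a # p, a # g @ p) \<in> pres_eq S R" using pres_eq.ctx[OF letter[OF a(2)], of "[]" p b] p a by simp
    also have "(a # g @ p, a # p @ g) \<in> pres_eq S R"
      using pres_eq.ctx[OF Cons.IH[OF p], of "[a]" "[]"] Cons.prems by simp
    finally (pres_eq.trans) show ?case by simp
  qed (use g in \<open>simp add: pres_eq.refl\<close>)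
  have "cl g \<otimes>\<^bsub>presented_group S R\<^esub> cl p = cl p \<otimes>\<^bsub>presented_group S R\<^esub> cl g"
    if p: "p \<in> lists (S \<times> UNIV)" for p
    using word[OF p] cl_eq_iff[of "g @ p"] mult_eq g p by simp
  then show ?thesis using g unfolding center_of_def by (auto simp: carrier_eq)
qed

end

context coxeter_longest
begin

section \<open>Passage to the quotient by the full twist\<close>

definition rels :: "('a word \<times> 'a word) set" where
  "rels = artin_rels S m \<union> {(pos D @ pos D, [])}"

lemma rels_eq: "rels = {(pos (alt s t (m s t)), pos (alt t s (m s t))) | s t. s \<in> S \<and> t \<in> S} \<union> {(pos (D @ D), [])}"
  by (simp add: rels_def artin_rels_def alt_word_eq)

lemma rels_lists: "rels \<subseteq> lists (S \<times> UNIV) \<times> lists (S \<times> UNIV)"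
proof -
  have "pos (alt s t n) \<in> lists (S \<times> UNIV)" if "s \<in> S" "t \<in> S" for s t n
    unfolding pos_lists by (rule alt_lists[OF that])
  moreover have "pos (D @ D) \<in> lists (S \<times> UNIV)" unfolding pos_lists using D_lists by simp
  ultimately show ?thesis unfolding rels_eq by blast
qed

sublocale presentation S rels
  by unfold_locales (rule rels_lists)

lemma braid_eq_pres_eq: "u \<doteq> v \<Longrightarrow> u \<in> lists S \<Longrightarrow> (pos u, pos v) \<in> pres_eq S rels"
  unfolding braid_eq_def
proof (induction rule: rtranclp_induct)
  case (step v w)
  then obtain x y s t where st: "s \<in> S" "t \<in> S"
    and vw: "v = x @ alt s t (m s t) @ y" "w = x @ alt t s (m s t) @ y"
    unfolding braid_step_def by blast
  have uv: "(pos u, pos v) \<in> pres_eq S rels" by (rule step.IH[OF step.prems])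
  then have "v \<in> lists S" using pres_eq_lists(2)[OF uv rels_lists] by simp
  then have "pos x \<in> lists (S \<times> UNIV)" "pos y \<in> lists (S \<times> UNIV)" unfolding vw pos_lists by simp_all
  moreover have "(pos (alt s t (m s t)), pos (alt t s (m s t))) \<in> pres_eq S rels"
    by (rule pres_eq.rel) (use st in \<open>auto simp: rels_eq\<close>)
  ultimately have "(pos v, pos w) \<in> pres_eq S rels"
    unfolding vw map_append by (intro pres_eq.ctx)
  with uv show ?case by (rule pres_eq.trans)
qed (simp add: pres_eq.refl)

text \<open>The left quotient of \<Delta> by \<open>s\<close>, unique up to braid moves by
  \<open>cancel_left\<close>.\<close>

definition co_head :: "'a \<Rightarrow> 'a list" where
  "co_head s = (SOME e. D \<doteq> s # e)"

lemma co_head: "s \<in> S \<Longrightarrow> D \<doteq> s # co_head s"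
  unfolding co_head_def using head_D someI_ex by metis

lemma co_head_lists: "s \<in> S \<Longrightarrow> co_head s \<in> lists S"
  using braid_eq_lists[OF co_head D_lists] by simp

text \<open>Since \<open>\<Delta>\<^sup>2 = 1\<close> in \<open>\<G>\<close>, a letter \<open>s\<^sup>-\<^sup>1\<close> may be replaced by the positive word \<open>(s\<^sup>-\<^sup>1\<Delta>)\<Delta>\<close>.\<close>
definition positive :: "'a word \<Rightarrow> 'a list" where
  "positive w = concat (map (\<lambda>(s, b). if b then [s] else co_head s @ D) w)"

lemma positive_append [simp]: "positive (u @ v) = positive u @ positive v"
  by (simp add: positive_def)

lemma positive_pos [simp]: "positive (pos u) = u"
  unfolding positive_def by (induction u) auto

lemma positive_lists: "w \<in> lists (S \<times> UNIV) \<Longrightarrow> positive w \<in> lists S"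
proof (induction w rule: list.induct)
  case (Cons a w)
  obtain s b where a: "a = (s, b)" "s \<in> S" using Cons.prems by auto
  have "positive [a] \<in> lists S" using a D_lists co_head_lists[OF a(2)] by (simp add: positive_def)
  then show ?case using Cons positive_append[of "[a]" w] by simp
qed (simp add: positive_def)

lemma inverse_letter: "s \<in> S \<Longrightarrow> s # co_head s @ D \<doteq> D @ D" "s \<in> S \<Longrightarrow> co_head s @ D @ [s] \<doteq> D @ D"
proof -
  assume s: "s \<in> S"
  show 1: "s # co_head s @ D \<doteq> D @ D"
    using braid_eq_append[OF braid_eq_sym[OF co_head[OF s]] braid_eq_refl] by simp
  have "[s] @ co_head s @ D @ [s] \<doteq> (D @ D) @ [s]" using braid_eq_append[OF 1 braid_eq_refl] by simp
  also have "\<dots> \<doteq> [s] @ D @ D" using braid_eq_sym[OF D_square_central[of "[s]"]] s by simp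
  finally show "co_head s @ D @ [s] \<doteq> D @ D" using cancel_left[of "[s]"] s by simp
qed

lemma pres_eq_positive:
  assumes "w \<in> lists (S \<times> UNIV)"
  shows "(w, pos (positive w)) \<in> pres_eq S rels"
  using assms
proof (induction w rule: list.induct)
  case (Cons a w)
  obtain s b where a: "a = (s, b)" "s \<in> S" using Cons.prems by auto
  have w: "w \<in> lists (S \<times> UNIV)" using Cons.prems by simp
  have "([a], pos (positive [a])) \<in> pres_eq S rels"
  proof (cases b)
    case True
    then show ?thesis using a by (auto simp: positive_def intro: pres_eq.refl)
  next
    case False
    let ?i = "[(s, False)]"
    let ?e = "pos (co_head s @ D)"
    have e: "co_head s @ D \<in> lists S" using D_lists co_head_lists[OF a(2)] by simp
    then have "?e \<in> lists (S \<times> UNIV)" by (simp only: pos_lists)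
    moreover have "([(s, False), (s, True)], []) \<in> pres_eq S rels"
      using pres_eq.cancel[OF a(2), of False] by simp
    ultimately have "([(s, False), (s, True)] @ ?e, ?e) \<in> pres_eq S rels"
      using pres_eq.ctx[of "[(s, False), (s, True)]" "[]" S rels "[]" ?e] by simp
    moreover have "(pos (s # co_head s @ D), pos (D @ D)) \<in> pres_eq S rels"
      by (rule braid_eq_pres_eq[OF inverse_letter(1)[OF a(2)]]) (use a e in simp)
    moreover have "(pos (D @ D), []) \<in> pres_eq S rels"
      by (rule pres_eq.rel) (simp add: rels_eq)
    ultimately have "(pos (s # co_head s @ D), []) \<in> pres_eq S rels" by (blast intro: pres_eq.trans)
    from pres_eq.ctx[OF this, of ?i "[]"] have "(?i @ pos (s # co_head s @ D), ?i) \<in> pres_eq S rels"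
      using a by simp
    moreover have "?i @ pos (s # co_head s @ D) = [(s, False), (s, True)] @ ?e" by simp
    ultimately have "(?i, ?e) \<in> pres_eq S rels"
      using pres_eq.trans[OF pres_eq.sym \<open>([(s, False), (s, True)] @ ?e, ?e) \<in> pres_eq S rels\<close>] by metis
    then show ?thesis using a False by (simp add: positive_def)
  qed
  from pres_eq_append[OF this Cons.IH[OF w]] show ?case
    using positive_append[of "[a]" w] by simp
qed (simp add: positive_def pres_eq.refl)

text \<open>Brings equality in the quotient back to the monoid. Full twists appear on both sides
  because the monoid has no inverses; transitivity pads them, and centrality moves them past a right
  context.\<close>

lemma pres_eq_imp_braid_eq:
  assumes "(u, v) \<in> pres_eq S rels"
  shows "\<exists>i j. positive u @ full_twists i \<doteq> positive v @ full_twists j"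
  using assms
proof (induction rule: pres_eq.induct)
  case (refl w)
  then show ?case by blast
next
  case (sym u v)
  then show ?case using braid_eq_sym by blast
next
  case (trans u v w)
  then obtain i j k l where ij: "positive u @ full_twists i \<doteq> positive v @ full_twists j"
    and kl: "positive v @ full_twists k \<doteq> positive w @ full_twists l" by blast
  have "positive u @ full_twists (i + k) \<doteq> (positive v @ full_twists j) @ full_twists k"
    using braid_eq_append[OF ij braid_eq_refl] by (simp add: full_twists_add)
  also have "\<dots> = positive v @ full_twists (k + j)" by (simp add: full_twists_add[symmetric] add.commute)
  also have "\<dots> \<doteq> positive w @ full_twists (l + j)"
    using braid_eq_append[OF kl braid_eq_refl] by (simp add: full_twists_add)
  finally show ?case by blast
next
  case (rel u v)
  then consider s t where "s \<in> S" "t \<in> S" "u = pos (alt s t (m s t))" "v = pos (alt t s (m s t))"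
    | "u = pos (D @ D)" "v = []" unfolding rels_eq by blast
  then show ?case
  proof cases
    case 1
    then show ?thesis unfolding 1 positive_pos by (intro exI[of _ 0]) (use braid_eq_alt 1 in blast)
  next
    case 2
    then show ?thesis unfolding 2 positive_pos
      by (intro exI[of _ 0] exI[of _ 1]) (simp add: full_twists_def positive_def)
  qed
next
  case (cancel x b)
  then show ?case using inverse_letter
    by (intro exI[of _ 0] exI[of _ 1]) (auto simp: full_twists_def positive_def)
next
  case (ctx u v w w')
  then obtain i j where ij: "positive u @ full_twists i \<doteq> positive v @ full_twists j" by blast
  have w': "positive w' \<in> lists S" using ctx positive_lists by blast
  have "positive (w @ u @ w') @ full_twists i = (positive w @ positive u) @ positive w' @ full_twists i" by simp
  also have "\<dots> \<doteq> (positive w @ positive u) @ full_twists i @ positive w'"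
    by (intro braid_eq_append[OF braid_eq_refl] full_twists_central w')
  also have "\<dots> = positive w @ (positive u @ full_twists i) @ positive w'" by simp
  also have "\<dots> \<doteq> positive w @ (positive v @ full_twists j) @ positive w'" by (rule braid_eq_context[OF ij])
  also have "\<dots> = (positive w @ positive v) @ full_twists j @ positive w'" by simp
  also have "\<dots> \<doteq> (positive w @ positive v) @ positive w' @ full_twists j"
    by (intro braid_eq_append[OF braid_eq_refl] braid_eq_sym[OF full_twists_central] w')
  finally show ?case by auto
qed

section \<open>Elements of the quotient with finite conjugation orbit\<close>

lemma finite_orbit_commutes:
  assumes x: "x \<in> lists S" and fin: "finite (conj_orbit (presented_group S rels) (cl (pos x)))"
    and s: "s \<in> S"
  shows "\<exists>k>0. replicate k s @ x \<doteq> x @ replicate k s"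
proof -
  interpret group "presented_group S rels" by (rule group_presented)
  have px: "pos x \<in> lists (S \<times> UNIV)" using x by (simp only: pos_lists)
  have ps: "[(s, True)] \<in> lists (S \<times> UNIV)" using s by simp
  obtain k :: nat where k: "0 < k"
    and eq: "cl [(s, True)] [^]\<^bsub>presented_group S rels\<^esub> k \<otimes>\<^bsub>presented_group S rels\<^esub> cl (pos x) =
      cl (pos x) \<otimes>\<^bsub>presented_group S rels\<^esub> cl [(s, True)] [^]\<^bsub>presented_group S rels\<^esub> k"
    using finite_orbit_commuting_power[OF fin] px ps unfolding carrier_eq by blast
  have rep: "concat (replicate k [(s, True)]) = pos (replicate k s)" by (induction k) auto
  have r: "replicate k s \<in> lists S" using s by auto
  have pr: "pos (replicate k s) \<in> lists (S \<times> UNIV)" using r by (simp only: pos_lists)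
  have "cl (pos (replicate k s @ x)) = cl (pos (x @ replicate k s))"
    using eq unfolding cl_pow[OF ps] rep mult_eq[OF pr px] mult_eq[OF px pr] by simp
  moreover have "pos (replicate k s @ x) \<in> lists (S \<times> UNIV)" unfolding pos_lists using x r by simp
  ultimately have "(pos (replicate k s @ x), pos (x @ replicate k s)) \<in> pres_eq S rels"
    using cl_eq_iff by blast
  then obtain i j where "(replicate k s @ x) @ full_twists i \<doteq> (x @ replicate k s) @ full_twists j"
    using pres_eq_imp_braid_eq unfolding positive_pos by (metis positive_pos)
  \<comment> \<open>Both words have length \<open>k + length x\<close>, so the twists
    cancel.\<close>
  then have "replicate k s @ x \<doteq> x @ replicate k s" by (rule full_twists_cancel) (use x r in auto)
  then show ?thesis using k by blast
qed

lemma cl_power_of_D: "cl (pos (concat (replicate n D))) \<in> {cl [], cl (pos D)}"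
proof (induction n)
  case (Suc n)
  have D: "pos D \<in> lists (S \<times> UNIV)" using D_lists by (simp only: pos_lists)
  have Dn: "pos (concat (replicate n D)) \<in> lists (S \<times> UNIV)"
    unfolding pos_lists using D_lists by (induction n) auto
  have "(pos (D @ D), []) \<in> pres_eq S rels"
    by (rule pres_eq.rel) (simp add: rels_eq)
  then have DD: "cl (pos D @ pos D) = cl []" using cl_eq_iff[of "pos D @ pos D"] D by simp
  have "cl (pos (concat (replicate (Suc n) D))) = cl (pos D) \<otimes>\<^bsub>presented_group S rels\<^esub> cl (pos (concat (replicate n D)))"
    using mult_eq[OF D Dn] by simp
  moreover have "cl (pos D) \<otimes>\<^bsub>presented_group S rels\<^esub> cl [] = cl (pos D)" using mult_eq[OF D, of "[]"] by simp
  moreover have "cl (pos D) \<otimes>\<^bsub>presented_group S rels\<^esub> cl (pos D) = cl []" using mult_eq[OF D D] DD by simp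
  ultimately show ?case using Suc by auto
qed simp

lemma finite_orbit_cases:
  assumes irr: "irreducible_coxeter S m" and g: "g \<in> carrier (presented_group S rels)"
    and fin: "finite (conj_orbit (presented_group S rels) g)"
  shows "g \<in> {cl [], cl (pos D)}"
proof -
  obtain w where w: "g = cl w" "w \<in> lists (S \<times> UNIV)" using g by (auto simp: carrier_eq)
  define x where "x = positive w"
  have x: "x \<in> lists S" using positive_lists w by (simp add: x_def)
  have gx: "g = cl (pos x)" using cl_eq_iff[OF w(2)] pres_eq_positive[OF w(2)] w by (simp add: x_def)
  have "\<forall>s\<in>S. \<exists>k t. 0 < k \<and> replicate k s @ x \<doteq> x @ replicate k t"
    using finite_orbit_commutes[OF x] fin unfolding gx by blast
  then obtain n where "x \<doteq> concat (replicate n D)" using power_of_D[OF irr x] by blast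
  then have "cl (pos x) = cl (pos (concat (replicate n D)))"
    using braid_eq_pres_eq x cl_eq_iff[of "pos x"] by (simp only: pos_lists)
  then show ?thesis using cl_power_of_D gx by simp
qed

lemma D_central:
  assumes fin: "finite (conj_orbit (presented_group S rels) (cl (pos D)))"
  shows "cl (pos D) \<in> center_of (presented_group S rels) (carrier (presented_group S rels))"
proof (rule central_if_commutes_with_letters)
  show "pos D \<in> lists (S \<times> UNIV)" using D_lists by (simp only: pos_lists)
  fix s assume s: "s \<in> S"
  obtain t where t: "t \<in> S" "s # D \<doteq> D @ [t]" using D_swap[OF s] by blast
  obtain k where k: "0 < k" "replicate k s @ D \<doteq> D @ replicate k s"
    using finite_orbit_commutes[OF D_lists fin s] by blast
  have "D @ replicate k t \<doteq> replicate k s @ D" by (rule braid_eq_sym[OF replicate_swap[OF t(2)]])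
  also note k(2)
  finally have "replicate k t \<doteq> replicate k s" by (rule cancel_left[OF _ D_lists])
  then have "s = t" using replicate_braid_eq[of k t "replicate k s"] k(1) by (cases k) auto
  then have "(pos (D @ [s]), pos (s # D)) \<in> pres_eq S rels"
    using braid_eq_pres_eq[OF braid_eq_sym[OF t(2)]] D_lists t(1) by simp
  then show "(pos D @ [(s, True)], (s, True) # pos D) \<in> pres_eq S rels" by simp
qed

lemma one_central: "cl [] \<in> center_of (presented_group S rels) (carrier (presented_group S rels))"
proof -
  interpret group "presented_group S rels" by (rule group_presented)
  show ?thesis unfolding one_eq[symmetric] center_of_def by simp
qed

lemma finite_orbit_central:
  assumes "irreducible_coxeter S m" "g \<in> carrier (presented_group S rels)"
    and "finite (conj_orbit (presented_group S rels) g)"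
  shows "g \<in> center_of (presented_group S rels) (carrier (presented_group S rels))"
proof (cases "g = cl []")
  case True
  then show ?thesis using one_central by simp
next
  case False
  then have "g = cl (pos D)" using finite_orbit_cases[OF assms] by simp
  then show ?thesis using D_central assms(3) by simp
qed

lemma center_finite_index:
  assumes irr: "irreducible_coxeter S m"
    and H: "subgroup H (presented_group S rels)" and fin: "finite (rcosets\<^bsub>presented_group S rels\<^esub> H)"
  shows "center_of (presented_group S rels) H = {cl []} \<or>
    center_of (presented_group S rels) H = {cl [], cl (pos D)} \<and>
    cl (pos D) \<in> center_of (presented_group S rels) (carrier (presented_group S rels))"
proof -
  interpret group "presented_group S rels" by (rule group_presented)
  let ?Z = "center_of (presented_group S rels) H"
  have HG: "H \<subseteq> carrier (presented_group S rels)" using H by (rule subgroup.subset)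
  have orbit: "finite (conj_orbit (presented_group S rels) z)" if "z \<in> ?Z" for z
    by (rule finite_index_centralizer_finite_orbit[OF H fin that])
  have ZG: "?Z \<subseteq> carrier (presented_group S rels)" using HG unfolding center_of_def by blast
  have "?Z \<subseteq> {cl [], cl (pos D)}" using finite_orbit_cases[OF irr] orbit ZG by blast
  moreover have "cl [] \<in> ?Z"
    using subgroup.one_closed[OF H] HG unfolding one_eq[symmetric] center_of_def by auto
  moreover have "cl (pos D) \<in> ?Z \<Longrightarrow>
      cl (pos D) \<in> center_of (presented_group S rels) (carrier (presented_group S rels))"
    using D_central orbit by blast
  ultimately show ?thesis by blast
qed

end

section \<open>From the given word for \<Delta> to the locale of longest words\<close>

lemma coxeter_longest_of_Delta_word:
  assumes "coxeter_matrix S m" "is_Delta_word S m d"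
  shows "coxeter_longest S m (map fst d)" "d = pos (map fst d)"
proof -
  interpret coxeter_system S m
    using assms(1) unfolding coxeter_matrix_def by unfold_locales auto
  let ?R = "coxeter_rels S m" and ?D = "map fst d"
  have d: "set d \<subseteq> S \<times> {True}" and long: "is_longest_element S m (word_class S ?R d)"
    and len: "length d = coxeter_length S m (word_class S ?R d)"
    using assms(2) unfolding is_Delta_word_def by auto
  show dD: "d = pos ?D" using d by (induction d) auto
  have DS: "?D \<in> lists S" using d by (induction d) auto
  have length_le: "coxeter_length S m (word_class S ?R (pos u)) \<le> length v" if "weq u v" for u v
    unfolding coxeter_length_def
    by (rule Least_le, rule bexI[of _ "pos v"]) (use that in \<open>simp_all add: word_class_def weq_def\<close>)
  \<comment> \<open>\<open>coxeter_length\<close> minimises over signed words and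
    \<open>reduced\<close> over positive ones. The minima agree because \<open>s\<close> and its
    inverse coincide in the Coxeter group.\<close>
  have forget_sign: "(w, pos (map fst w)) \<in> pres_eq S ?R" if "w \<in> lists (S \<times> UNIV)" for w
    using that
  proof (induction w rule: list.induct)
    case (Cons a w)
    obtain s b where a: "a = (s, b)" "s \<in> S" using Cons.prems by auto
    interpret P: presentation S ?R by unfold_locales (rule coxeter_rels_lists)
    have "([(s, b)], [(s, True)]) \<in> pres_eq S ?R"
    proof (cases b)
      case False
      have "([(s, True), (s, True)], []) \<in> pres_eq S ?R" using weq_square[OF a(2)] by (simp add: weq_def)
      from pres_eq.ctx[OF this, of "[(s, False)]" "[]"]
      have 1: "([(s, False), (s, True), (s, True)], [(s, False)]) \<in> pres_eq S ?R" using a by simp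
      have "([(s, False), (s, True)], []) \<in> pres_eq S ?R" using pres_eq.cancel[OF a(2), of False] by simp
      from pres_eq.ctx[OF this, of "[]" "[(s, True)]"]
      have "([(s, False), (s, True), (s, True)], [(s, True)]) \<in> pres_eq S ?R" using a by simp
      from pres_eq.trans[OF pres_eq.sym[OF 1] this] show ?thesis using False by simp
    qed (use a in \<open>auto intro: pres_eq.refl\<close>)
    from P.pres_eq_append[OF this Cons.IH] show ?case using Cons.prems a by simp
  qed (simp add: pres_eq.refl)
  have reduced_length: "coxeter_length S m (word_class S ?R (pos u)) = length u" if u: "reduced u" for u
    unfolding coxeter_length_def
  proof (rule Least_equality)
    have "pos u \<in> lists (S \<times> UNIV)" using u by (simp add: reduced_def)
    then show "\<exists>w\<in>word_class S ?R (pos u). length w = length u"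
      by (intro bexI[of _ "pos u"]) (simp_all add: word_class_def pres_eq.refl)
    fix n assume "\<exists>w\<in>word_class S ?R (pos u). length w = n"
    then obtain w where w: "(pos u, w) \<in> pres_eq S ?R" "length w = n" by (auto simp: word_class_def)
    have "weq u (map fst w)" unfolding weq_def
      by (rule pres_eq.trans[OF w(1) forget_sign[OF pres_eq_lists(2)[OF w(1) coxeter_rels_lists]]])
    then have "length u \<le> length (map fst w)" using u by (simp only: reduced_def)
    then show "length u \<le> n" using w by simp
  qed
  show "coxeter_longest S m ?D"
  proof unfold_locales
    show "reduced ?D" unfolding reduced_def
    proof (intro conjI allI impI DS)
      fix v assume "weq ?D v"
      then show "length ?D \<le> length v" using length_le[of ?D v] len unfolding dD[symmetric] by simp
    qed
    fix w assume w: "reduced w"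
    then have "word_class S ?R (pos w) \<in> carrier (coxeter_group S m)"
      by (simp add: coxeter_group_def presented_group_def word_class_def quotientI reduced_def)
    then show "length w \<le> length ?D"
      using long len reduced_length[OF w] unfolding is_longest_element_def length_map by metis
  qed
qed

theorem theorem4p8:
  fixes S :: "'a set" and m :: "'a \<Rightarrow> 'a \<Rightarrow> nat" and d :: "'a word"
  assumes "finite S"
    and "coxeter_matrix S m"
    and "finite (carrier (coxeter_group S m))"
    and "irreducible_coxeter S m"
    and "\<exists>x\<in>carrier (coxeter_group S m). \<exists>y\<in>carrier (coxeter_group S m).
           x \<otimes>\<^bsub>coxeter_group S m\<^esub> y \<noteq> y \<otimes>\<^bsub>coxeter_group S m\<^esub> x"
    and "is_Delta_word S m d"
  shows "(\<forall>g\<in>carrier (artin_mod_Delta2 S m d).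
            finite (conj_orbit (artin_mod_Delta2 S m d) g) \<longrightarrow>
              conj_orbit (artin_mod_Delta2 S m d) g = {g} \<and>
              g \<in> center_of (artin_mod_Delta2 S m d) (carrier (artin_mod_Delta2 S m d)))
       \<and> (\<forall>H. subgroup H (artin_mod_Delta2 S m d) \<and>
               finite (rcosets\<^bsub>artin_mod_Delta2 S m d\<^esub> H) \<longrightarrow>
             center_of (artin_mod_Delta2 S m d) H = {\<one>\<^bsub>artin_mod_Delta2 S m d\<^esub>}
             \<or> (center_of (artin_mod_Delta2 S m d) H =
                  {\<one>\<^bsub>artin_mod_Delta2 S m d\<^esub>, word_class S (artin_rels S m \<union> {(d @ d, [])}) d}
                \<and> word_class S (artin_rels S m \<union> {(d @ d, [])}) d
                    \<in> center_of (artin_mod_Delta2 S m d) (carrier (artin_mod_Delta2 S m d))))"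
proof -
  let ?D = "map fst d"
  interpret coxeter_longest S m ?D by (rule coxeter_longest_of_Delta_word) (use assms in blast)+
  interpret group "presented_group S rels" by (rule group_presented)
  have d: "d = pos ?D" by (rule coxeter_longest_of_Delta_word) (use assms in blast)+
  have R: "artin_rels S m \<union> {(d @ d, [])} = rels" unfolding rels_def d[symmetric] ..
  have G: "artin_mod_Delta2 S m d = presented_group S rels" unfolding artin_mod_Delta2_def R ..
  let ?G = "presented_group S rels"
  have "conj_orbit ?G g = {g} \<and> g \<in> center_of ?G (carrier ?G)"
    if "g \<in> carrier ?G" "finite (conj_orbit ?G g)" for g
    using finite_orbit_central[OF assms(4) that] conj_orbit_central by blast
  moreover have "center_of ?G H = {\<one>\<^bsub>?G\<^esub>} \<or>
      center_of ?G H = {\<one>\<^bsub>?G\<^esub>, cl d} \<and> cl d \<in> center_of ?G (carrier ?G)"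
    if "subgroup H ?G" "finite (rcosets\<^bsub>?G\<^esub> H)" for H
    using center_finite_index[OF assms(4) that] unfolding one_eq d[symmetric] .
  ultimately show ?thesis unfolding G R by blast
qed

end
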